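(* Consider the system on $SO(3)$ with deterministic dynamics and discrete noisy measurements $$\frac{d}{dt}R_t=R_t(\omega(t))_\times,\qquad Y_k=\begin{pmatrix} Y_k^0 \\ Y_k^1 \end{pmatrix}=\begin{pmatrix} R_{t_k}^Td_k^0+V_k^0 \\ R_{t_k}^Td_k^1+V_k^1 \end{pmatrix},\quad k=1,2,\dots,$$ where $\omega(t)\in\mathbb R^3$ is known, $t_1\le t_2\le\cdots$ are the measurement times, $d_k^0,d_k^1\in\mathbb R^3$ are known vectors, and $V_k^0,V_k^1$ are mutually independent centered Gaussian vectors with covariance matrices $(\sigma_k^0)^2I_3$ and $(\sigma_k^1)^2I_3$, with $\sigma_k^0,\sigma_k^1>0$. Let $H_k^i=(d_k^i)_\times$ for $i=0,1$, fix $n\geq 1$, and let $$J=\sum_{k=1}^n\left(\frac1{(\sigma_k^0)^2}{H_k^0}^TH_k^0+\frac1{(\sigma_k^1)^2}{H_k^1}^TH_k^1\right),$$ assumed invertible. Let $\hat R_{t_n}=\hat R_{t_n}(Y_1,\dots,Y_n)$ be any estimator of the attitude $R_{t_n}$ that is unbiased in the sense that $\mathbf E\left(\log(R_{t_n}\hat R_{t_n}^T)\right)=0$ for the values of the unknown parameter $R_{t_n}$, and let $P=\mathbf E\left(\log(R_{t_n}\hat R_{t_n}^T)\log(R_{t_n}\hat R_{t_n}^T)^T\right)$. Then, up to terms of order $\mathbf E\left(\|\log(R_{t_n}\hat R_{t_n}^T)\|^3\right)$, $$P\succeq J^{-1}-\frac1{12}\left(\mathrm{Tr}(P)I_3-P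\right)J^{-1}-\frac1{12}J^{-1}\left(\mathrm{Tr}(P)I_3-P\right).$$
   Context: For $a\in\mathbb R^3$, $(a)_\times\in\mathbb R^{3\times3}$ is the skew-symmetric matrix with $(a)_\times u=a\times u$. The Lie algebra of $SO(3)$ is identified with $\mathbb R^3$; $\exp:\mathbb R^3\to SO(3)$ is $\exp(\xi)=\mathrm{expm}[(\xi)_\times]$, where $\mathrm{expm}$ is the matrix exponential, and $\log$ is its inverse, defined around the identity (values in the ball of radius $\pi$). The unknown parameter is the deterministic rotation $R_{t_n}$ (since $\omega$ is known it determines $R_{t_k}$ for all $k\le n$), with no prior information on it; $\mathbf E$ is expectation under the law of $Y_1,\dots,Y_n$ for the true $R_{t_n}$. $\succeq$ is the Loewner order. "Up to terms of order $\mathbf E(\|\log(R_{t_n}\hat R_{t_n}^T)\|^3)$" means that the inequality holds after adding to its right-hand side some symmetric matrix $E$ with $\|E\|\le c\,\mathbf E(\|\log(R_{t_n}\hat R_{t_n}^T)\|^3)$, where $c$ depends only on $J^{-1}$. Regularity convention: $\log(R_{t_n}\hat R_{t_n}^T)$ is defined almost surely, and for every $\xi\in\mathbb R^3$ the unbiasedness identity with parameter $\exp(s\xi)R_{t_n}$ in place of $R_{t_n}$ (for $s$ near $0$), written as an integral against the density of $(Y_1,\dots,Y_n)$, may be differentiated at $s=0$ under the integral sign. *)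

theory Defs
  imports "HOL-Probability.Probability"
begin

definition cross_matrix :: "real^3 \<Rightarrow> real^3^3" where
  "cross_matrix a = matrix (cross3 a)"

lemma cross_matrix_mult: "cross_matrix a *v u = cross3 a u"
  using bilinear_cross unfolding bilinear_def cross_matrix_def by (simp add: matrix_works linear_matrix_vector_mul_eq)

definition matrix_pow :: "real^3^3 \<Rightarrow> nat \<Rightarrow> real^3^3" where
  "matrix_pow A k = (((**) A) ^^ k) (mat 1)"

(* The library constant exp is not available here: the instance of times for vec is
   the componentwise product, so real^3^3 is not a normed algebra. *)
definition expm :: "real^3^3 \<Rightarrow> real^3^3" where
  "expm A = (\<Sum>k. (1 / fact k) *\<^sub>R matrix_pow A k)"

definition so3_exp :: "real^3 \<Rightarrow> real^3^3" where
  "so3_exp \<xi> = expm (cross_matrix \<xi>)"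

(* The logarithm is meaningful exactly on so3_log_dom (the rotations of angle less than pi);
   elsewhere inv_into returns an unspecified constant. *)
definition so3_log_dom :: "(real^3^3) set" where
  "so3_log_dom = so3_exp ` ball 0 pi"

definition so3_log :: "real^3^3 \<Rightarrow> real^3" where
  "so3_log = inv_into (ball 0 pi) so3_exp"

definition attitude_trajectory ::
    "real set \<Rightarrow> (real \<Rightarrow> real^3) \<Rightarrow> (real \<Rightarrow> real^3^3) \<Rightarrow> bool" where
  "attitude_trajectory T \<omega> X \<longleftrightarrow>
     (\<forall>s\<in>T. rotation_matrix (X s) \<and>
        (X has_vector_derivative (X s ** cross_matrix (\<omega> s))) (at s within T))"

definition gaussian_density :: "real^3^3 \<Rightarrow> real^3 \<Rightarrow> real" where
  "gaussian_density S x =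
     exp (- (x \<bullet> (matrix_inv S *v x)) / 2) / sqrt ((2 * pi) ^ 3 * det S)"

(* A record (Y_1, ..., Y_n) is a function y, extensional on obs_index n, whose value
   y (k, i) is the block Y_k^i. *)
definition obs_index :: "nat \<Rightarrow> (nat \<times> nat) set" where
  "obs_index n = {1..n} \<times> {0, 1}"

type_synonym obs = "nat \<times> nat \<Rightarrow> real^3"

definition obs_space :: "nat \<Rightarrow> obs measure" where
  "obs_space n = (\<Pi>\<^sub>M j\<in>obs_index n. borel)"

definition obs_noise ::
    "(nat \<Rightarrow> real) \<Rightarrow> (nat \<Rightarrow> nat \<Rightarrow> real^3) \<Rightarrow> (real \<Rightarrow> real^3^3) \<Rightarrow> nat \<times> nat \<Rightarrow> obs \<Rightarrow> real^3"
  where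
  "obs_noise t d X = (\<lambda>(k, i) y. y (k, i) - transpose (X (t k)) *v d k i)"

(* mu is the law of (Y_1, ..., Y_n) when the attitude follows X: under mu, the
   V_k^i = Y_k^i - X(t_k)^T d_k^i are independent with law N(0, (sigma_k^i)^2 I). *)
definition obs_law ::
    "nat \<Rightarrow> (nat \<Rightarrow> real) \<Rightarrow> (nat \<Rightarrow> nat \<Rightarrow> real^3) \<Rightarrow> (nat \<Rightarrow> nat \<Rightarrow> real) \<Rightarrow>
     (real \<Rightarrow> real^3^3) \<Rightarrow> obs measure \<Rightarrow> bool" where
  "obs_law n t d \<sigma> X \<mu> \<longleftrightarrow>
     prob_space \<mu> \<and> sets \<mu> = sets (obs_space n) \<and>
     prob_space.indep_vars \<mu> (\<lambda>_. borel) (obs_noise t d X) (obs_index n) \<and>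
     (\<forall>(k, i)\<in>obs_index n. distributed \<mu> lborel (obs_noise t d X (k, i))
        (\<lambda>v. ennreal (gaussian_density ((\<sigma> k i)\<^sup>2 *\<^sub>R mat 1) v)))"

(* The density of obs_law with respect to Lebesgue measure. *)
definition obs_density ::
    "nat \<Rightarrow> (nat \<Rightarrow> real) \<Rightarrow> (nat \<Rightarrow> nat \<Rightarrow> real^3) \<Rightarrow> (nat \<Rightarrow> nat \<Rightarrow> real) \<Rightarrow>
     (real \<Rightarrow> real^3^3) \<Rightarrow> obs \<Rightarrow> real" where
  "obs_density n t d \<sigma> X y =
     (\<Prod>(k, i)\<in>obs_index n. gaussian_density ((\<sigma> k i)\<^sup>2 *\<^sub>R mat 1) (obs_noise t d X (k, i) y))"

definition info_matrix ::
    "nat \<Rightarrow> (nat \<Rightarrow> nat \<Rightarrow> real^3) \<Rightarrow> (nat \<Rightarrow> nat \<Rightarrow> real) \<Rightarrow> real^3^3" where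
  "info_matrix n d \<sigma> =
     (\<Sum>k=1..n. \<Sum>i\<in>{0, 1}.
        (1 / (\<sigma> k i)\<^sup>2) *\<^sub>R (transpose (cross_matrix (d k i)) ** cross_matrix (d k i)))"

definition attitude_error :: "(obs \<Rightarrow> real^3^3) \<Rightarrow> real^3^3 \<Rightarrow> obs \<Rightarrow> real^3" where
  "attitude_error Rhat Q y = so3_log (Q ** transpose (Rhat y))"

definition unbiased_at ::
    "(real^3^3 \<Rightarrow> obs measure) \<Rightarrow> (obs \<Rightarrow> real^3^3) \<Rightarrow> real^3^3 \<Rightarrow> bool" where
  "unbiased_at \<mu> Rhat Q \<longleftrightarrow>
     (AE y in \<mu> Q. Q ** transpose (Rhat y) \<in> so3_log_dom) \<and>
     (\<integral>y. attitude_error Rhat Q y \<partial>\<mu> Q) = 0"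

definition error_covariance ::
    "(real^3^3 \<Rightarrow> obs measure) \<Rightarrow> (obs \<Rightarrow> real^3^3) \<Rightarrow> real^3^3 \<Rightarrow> real^3^3" where
  "error_covariance \<mu> Rhat Q =
     (\<integral>y. (\<chi> i j. attitude_error Rhat Q y $ i * attitude_error Rhat Q y $ j) \<partial>\<mu> Q)"

definition differentiable_under_integral ::
    "'a measure \<Rightarrow> (real \<Rightarrow> 'a \<Rightarrow> real^3) \<Rightarrow> real \<Rightarrow> bool" where
  "differentiable_under_integral M F s0 \<longleftrightarrow>
     (\<forall>\<^sub>F s in nhds s0. integrable M (F s)) \<and>
     (AE y in M. (\<lambda>s. F s y) differentiable (at s0)) \<and>
     integrable M (\<lambda>y. vector_derivative (\<lambda>s. F s y) (at s0)) \<and>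
     ((\<lambda>s. \<integral>y. F s y \<partial>M) has_vector_derivative
        (\<integral>y. vector_derivative (\<lambda>s. F s y) (at s0) \<partial>M)) (at s0)"

definition loewner_le :: "real^3^3 \<Rightarrow> real^3^3 \<Rightarrow> bool" where
  "loewner_le A B \<longleftrightarrow> transpose (B - A) = B - A \<and> (\<forall>x. 0 \<le> x \<bullet> ((B - A) *v x))"

end

theory Submission
  imports Defs
begin

text \<open>Perturbing the unknown attitude to \<open>so3_exp (s *\<^sub>R \<xi>) ** Q\<close> multiplies the whole trajectory by
  \<open>so3_exp (s *\<^sub>R \<xi>)\<close> on the left, so the observations have a score \<open>S\<close> in direction \<open>\<xi>\<close> that is
  linear in the noise and satisfies \<open>E S\<^sup>2 = \<xi> \<bullet> J \<xi>\<close>.  Differentiating the unbiasedness identity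
  gives \<open>E (S e + v) = 0\<close>, where \<open>e\<close> is the error and \<open>v\<close> is the derivative of
  \<open>s \<mapsto> log (exp (s \<xi>) exp e)\<close> at \<open>0\<close>, namely
  \<open>v = \<xi> - e \<times> \<xi> / 2 + e \<times> (e \<times> \<xi>) / 12\<close> up to an error of norm at most \<open>\<parallel>e\<parallel>\<^sup>3 \<parallel>\<xi>\<parallel>\<close>.
  The term linear in \<open>e\<close> has mean zero and the quadratic one has mean \<open>- (Tr P I - P) \<xi> / 12\<close>.
  Expanding \<open>0 \<le> E (x \<bullet> e + S)\<^sup>2\<close> with \<open>\<xi> = J\<^sup>-\<^sup>1 x\<close> is then the claimed inequality, evaluated at
  \<open>x\<close>.\<close>

section \<open>The exponential and the logarithm of SO(3)\<close>

lemma cross_matrix_nth: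
  "cross_matrix a $ 1 $ 1 = 0" "cross_matrix a $ 1 $ 2 = - a $ 3" "cross_matrix a $ 1 $ 3 = a $ 2"
  "cross_matrix a $ 2 $ 1 = a $ 3" "cross_matrix a $ 2 $ 2 = 0" "cross_matrix a $ 2 $ 3 = - a $ 1"
  "cross_matrix a $ 3 $ 1 = - a $ 2" "cross_matrix a $ 3 $ 2 = a $ 1" "cross_matrix a $ 3 $ 3 = 0"
  by (simp_all add: cross_matrix_def matrix_def cross3_def vector_def axis_def)

lemmas so3_entries = vec_eq_iff forall_3 matrix_matrix_mult_def matrix_vector_mult_def sum_3
  mat_def transpose_def cross_matrix_nth cross3_def vector_def inner_vec_def

lemma scaleR_matrix_mult:
  fixes A B :: "real^3^3"
  shows "(c *\<^sub>R A) ** B = c *\<^sub>R (A ** B)" "A ** (c *\<^sub>R B) = c *\<^sub>R (A ** B)"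
  by (simp_all add: matrix_scalar_ac scalar_matrix_assoc)

lemma bounded_bilinear_matrix_mult: "bounded_bilinear ((**) :: real^3^3 \<Rightarrow> real^3^3 \<Rightarrow> real^3^3)"
  unfolding bilinear_conv_bounded_bilinear[symmetric] bilinear_def
  by (auto intro!: linearI simp: matrix_add_ldistrib scaleR_matrix_mult so3_entries algebra_simps)

lemma bounded_bilinear_matrix_vector_mult: "bounded_bilinear ((*v) :: real^3^3 \<Rightarrow> real^3 \<Rightarrow> real^3)"
  unfolding bilinear_conv_bounded_bilinear[symmetric] bilinear_def
  by (auto intro!: linearI simp: so3_entries algebra_simps)

lemma bounded_linear_transpose: "bounded_linear (transpose :: real^3^3 \<Rightarrow> real^3^3)"
  by (rule linear_conv_bounded_linear[THEN iffD1], rule linearI) (simp_all add: so3_entries)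

lemma cross_matrix_scale: "cross_matrix (c *\<^sub>R a) = c *\<^sub>R cross_matrix a"
  by (simp add: so3_entries)

lemma transpose_cross_matrix: "transpose (cross_matrix a) = - cross_matrix a"
  by (simp add: so3_entries)

lemma cross_matrix_cube:
  "cross_matrix a ** (cross_matrix a ** cross_matrix a) = - (norm a)\<^sup>2 *\<^sub>R cross_matrix a"
  by (simp add: so3_entries power2_norm_eq_inner algebra_simps)

lemma matrix_pow_cross_matrix:
  fixes a :: "real^3"
  defines "K \<equiv> cross_matrix a"
  shows "matrix_pow K (2 * j + 1) = (- (norm a)\<^sup>2) ^ j *\<^sub>R K"
    and "matrix_pow K (2 * j + 2) = (- (norm a)\<^sup>2) ^ j *\<^sub>R (K ** K)"
proof -
  have *: "matrix_pow K (Suc k) = K ** matrix_pow K k" for k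
    by (simp add: matrix_pow_def)
  have **: "matrix_pow K (2 * j + 1) = (- (norm a)\<^sup>2) ^ j *\<^sub>R K"
  proof (induction j)
    case 0
    show ?case by (simp add: matrix_pow_def)
  next
    case (Suc j)
    have "matrix_pow K (2 * Suc j + 1) = K ** (K ** matrix_pow K (2 * j + 1))"
      by (simp add: *)
    also have "\<dots> = (- (norm a)\<^sup>2) ^ j *\<^sub>R (K ** (K ** K))"
      unfolding Suc by (simp add: scaleR_matrix_mult)
    finally show ?case
      unfolding K_def cross_matrix_cube by simp
  qed
  show "matrix_pow K (2 * j + 1) = (- (norm a)\<^sup>2) ^ j *\<^sub>R K" by (fact **)
  have "matrix_pow K (2 * j + 2) = K ** matrix_pow K (2 * j + 1)"
    by (simp add: *)
  then show "matrix_pow K (2 * j + 2) = (- (norm a)\<^sup>2) ^ j *\<^sub>R (K ** K)"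
    unfolding ** by (simp add: scaleR_matrix_mult)
qed

text \<open>At \<open>\<xi> = 0\<close> both quotients are \<open>0\<close> by convention, which is harmless since they multiply a zero
  matrix.\<close>

lemma so3_exp_rodrigues:
  fixes \<xi> :: "real^3"
  defines "K \<equiv> cross_matrix \<xi>"
  shows "so3_exp \<xi> = mat 1 + (sin (norm \<xi>) / norm \<xi>) *\<^sub>R K
           + ((1 - cos (norm \<xi>)) / (norm \<xi>)\<^sup>2) *\<^sub>R (K ** K)"
proof (cases "\<xi> = 0")
  case True
  then have K: "K = 0"
    by (simp add: K_def so3_entries)
  have "matrix_pow K k = (if k = 0 then mat 1 else 0)" for k
    by (cases k) (simp_all add: matrix_pow_def K)
  then have "(\<lambda>k. (1 / fact k) *\<^sub>R matrix_pow K k) = (\<lambda>k. if k = 0 then mat 1 else 0)"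
    by auto
  then have "(\<lambda>k. (1 / fact k) *\<^sub>R matrix_pow K k) sums mat 1"
    using sums_single[of 0 "\<lambda>_. mat 1 :: real^3^3"] by simp
  then show ?thesis
    using True K by (simp add: so3_exp_def expm_def K_def sums_iff)
next
  case False
  define \<theta> where "\<theta> = norm \<xi>"
  have \<theta>: "\<theta> > 0"
    using False by (simp add: \<theta>_def)
  define f where "f k = (if k = 0 then mat 1 + (1 / \<theta>\<^sup>2) *\<^sub>R (K ** K) else 0)
    + ((sin_coeff k *\<^sub>R \<theta> ^ k) * (1 / \<theta>)) *\<^sub>R K
    - ((cos_coeff k *\<^sub>R \<theta> ^ k) * (1 / \<theta>\<^sup>2)) *\<^sub>R (K ** K)" for k
  have "(1 / fact k) *\<^sub>R matrix_pow K k = f k" for k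
  proof -
    have "k = 0 \<or> (\<exists>j. k = 2 * j + 1) \<or> (\<exists>j. k = 2 * j + 2)"
      by presburger
    then consider "k = 0" | j where "k = 2 * j + 1" | j where "k = 2 * j + 2"
      by blast
    then show ?thesis
    proof cases
      case 1
      then show ?thesis by (simp add: f_def matrix_pow_def)
    next
      case (2 j)
      have "(- \<theta>\<^sup>2) ^ j = (-1) ^ j * \<theta> ^ (2 * j)"
        by (metis mult_minus1 power_mult_distrib power_mult)
      then show ?thesis
        using \<theta> unfolding 2 K_def matrix_pow_cross_matrix f_def
        by (simp add: sin_coeff_def cos_coeff_def \<theta>_def[symmetric])
    next
      case (3 j)
      have "(- \<theta>\<^sup>2) ^ j = (-1) ^ j * \<theta> ^ (2 * j)"
        by (metis mult_minus1 power_mult_distrib power_mult)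
      moreover have "\<theta> ^ (2 * j + 2) * (1 / \<theta>\<^sup>2) = \<theta> ^ (2 * j)"
        using \<theta> by (simp add: power_add power2_eq_square)
      moreover have "sin_coeff (2 * j + 2) = 0" "cos_coeff (2 * j + 2) = - ((-1) ^ j / fact (2 * j + 2))"
        by (simp_all add: sin_coeff_def cos_coeff_def)
      moreover have "2 * j + 2 \<noteq> 0"
        by simp
      ultimately show ?thesis
        unfolding 3 K_def matrix_pow_cross_matrix f_def
        by (simp only: \<theta>_def[symmetric] mult.assoc real_scaleR_def scaleR_scaleR if_False
            scaleR_minus_left mult_minus_left) simp
    qed
  qed
  moreover have "f sums (mat 1 + (1 / \<theta>\<^sup>2) *\<^sub>R (K ** K) + (sin \<theta> * (1 / \<theta>)) *\<^sub>R K
      - (cos \<theta> * (1 / \<theta>\<^sup>2)) *\<^sub>R (K ** K))"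
    unfolding f_def
    by (intro sums_diff sums_add sums_scaleR_left sums_mult2 sin_converges cos_converges)
      (rule sums_single[of 0 "\<lambda>_. mat 1 + (1 / \<theta>\<^sup>2) *\<^sub>R (K ** K)"])
  ultimately have "(\<lambda>k. (1 / fact k) *\<^sub>R matrix_pow K k) sums
      (mat 1 + (1 / \<theta>\<^sup>2) *\<^sub>R (K ** K) + (sin \<theta> * (1 / \<theta>)) *\<^sub>R K
      - (cos \<theta> * (1 / \<theta>\<^sup>2)) *\<^sub>R (K ** K))"
    by presburger
  then show ?thesis
    unfolding so3_exp_def expm_def K_def[symmetric] \<theta>_def[symmetric]
    by (simp add: sums_iff algebra_simps diff_divide_distrib)
qed

lemma so3_exp_line:
  "so3_exp (s *\<^sub>R \<xi>) = mat 1 + (sin (s * norm \<xi>) / norm \<xi>) *\<^sub>R cross_matrix \<xi>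
     + ((1 - cos (s * norm \<xi>)) / (norm \<xi>)\<^sup>2) *\<^sub>R (cross_matrix \<xi> ** cross_matrix \<xi>)"
proof (cases "s = 0")
  case True
  then show ?thesis
    by (simp add: so3_exp_rodrigues cross_matrix_scale)
next
  case False
  then show ?thesis
    unfolding so3_exp_rodrigues[of "s *\<^sub>R \<xi>"] cross_matrix_scale
    by (cases "s > 0") (simp_all add: scaleR_matrix_mult power_mult_distrib power2_eq_square)
qed

lemma so3_exp_0: "so3_exp 0 = mat 1"
  using so3_exp_line[of 0 0] by simp

lemma has_vector_derivative_so3_exp_line:
  "((\<lambda>s. so3_exp (s *\<^sub>R \<xi>)) has_vector_derivative cross_matrix \<xi>) (at 0)"
proof -
  have "((\<lambda>s. sin (s * norm \<xi>) / norm \<xi>) has_vector_derivative (cos (0 * norm \<xi>) * (1 * norm \<xi>)) / norm \<xi>) (at 0)"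
    unfolding has_real_derivative_iff_has_vector_derivative[symmetric]
    by (auto intro!: derivative_eq_intros)
  moreover have "((\<lambda>s. (1 - cos (s * norm \<xi>)) / (norm \<xi>)\<^sup>2) has_vector_derivative 0) (at 0)"
    unfolding has_real_derivative_iff_has_vector_derivative[symmetric]
    by (cases "\<xi> = 0") (auto intro!: derivative_eq_intros)
  ultimately have "((\<lambda>s. so3_exp (s *\<^sub>R \<xi>)) has_vector_derivative
     0 + ((cos (0 * norm \<xi>) * (1 * norm \<xi>)) / norm \<xi>) *\<^sub>R cross_matrix \<xi>
     + 0 *\<^sub>R (cross_matrix \<xi> ** cross_matrix \<xi>)) (at 0)"
    unfolding so3_exp_line
    by (intro has_vector_derivative_add has_vector_derivative_const
        bounded_linear.has_vector_derivative[OF bounded_linear_scaleR_left])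
  moreover have "cross_matrix 0 = 0"
    by (simp add: so3_entries)
  ultimately show ?thesis
    by (cases "\<xi> = 0") simp_all
qed

lemma rotation_matrix_so3_exp: "rotation_matrix (so3_exp \<xi>)"
proof (cases "\<xi> = 0")
  case True
  then show ?thesis
    by (simp add: so3_exp_0 rotation_matrix_def orthogonal_matrix_id)
next
  case False
  define a b :: real where "a = sin (norm \<xi>) / norm \<xi>" and "b = (1 - cos (norm \<xi>)) / (norm \<xi>)\<^sup>2"
  define q where "q = \<xi>$1 * \<xi>$1 + \<xi>$2 * \<xi>$2 + \<xi>$3 * \<xi>$3"
  have q: "(norm \<xi>)\<^sup>2 = q"
    by (simp add: power2_norm_eq_inner inner_vec_def sum_3 q_def)
  have "norm \<xi> > 0"
    using False by simp
  then have ab: "2 * b = a\<^sup>2 + b\<^sup>2 * q"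
  proof -
    have "a\<^sup>2 + b\<^sup>2 * q = (1 - (cos (norm \<xi>))\<^sup>2) / q + (1 - cos (norm \<xi>))\<^sup>2 / q"
      unfolding a_def b_def q power_divide sin_squared_eq
      using \<open>norm \<xi> > 0\<close> q by (simp add: power2_eq_square)
    also have "\<dots> = 2 * b"
      unfolding b_def q add_divide_distrib[symmetric] by (simp add: power2_eq_square algebra_simps)
    finally show ?thesis by simp
  qed
  have E: "so3_exp \<xi> = mat 1 + a *\<^sub>R cross_matrix \<xi> + b *\<^sub>R (cross_matrix \<xi> ** cross_matrix \<xi>)"
    by (simp add: so3_exp_rodrigues a_def b_def)
  have "transpose (so3_exp \<xi>) ** so3_exp \<xi>
      = mat 1 + (2 * b - a\<^sup>2 - b\<^sup>2 * q) *\<^sub>R (cross_matrix \<xi> ** cross_matrix \<xi>)"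
    unfolding E q_def by (simp add: so3_entries algebra_simps power2_eq_square)
  then have "transpose (so3_exp \<xi>) ** so3_exp \<xi> = mat 1"
    using ab by simp
  moreover have "det (so3_exp \<xi>) = 1 + q * (a\<^sup>2 + b\<^sup>2 * q - 2 * b)"
    unfolding E q_def det_3 by (simp add: so3_entries algebra_simps power2_eq_square)
  then have "det (so3_exp \<xi>) = 1"
    using ab by simp
  ultimately show ?thesis
    by (simp add: rotation_matrix_def orthogonal_matrix)
qed

definition vee :: "real^3^3 \<Rightarrow> real^3" where
  "vee M = (1 / 2) *\<^sub>R vector [M$3$2 - M$2$3, M$1$3 - M$3$1, M$2$1 - M$1$2]"

lemma bounded_linear_vee: "bounded_linear vee"
  by (rule linear_conv_bounded_linear[THEN iffD1], rule linearI)
    (simp_all add: vee_def so3_entries algebra_simps)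

lemma bounded_linear_trace: "bounded_linear (trace :: real^3^3 \<Rightarrow> real)"
  by (rule linear_conv_bounded_linear[THEN iffD1], rule linearI)
    (simp_all add: trace_def sum_3 algebra_simps)

lemma trace_so3_exp: "trace (so3_exp e) = 1 + 2 * cos (norm e)"
proof (cases "e = 0")
  case False
  have "trace (mat 1 + a *\<^sub>R cross_matrix e + b *\<^sub>R (cross_matrix e ** cross_matrix e))
      = 3 - 2 * b * (norm e)\<^sup>2" for a b
    unfolding power2_norm_eq_inner by (simp add: trace_def so3_entries algebra_simps)
  then show ?thesis
    unfolding so3_exp_rodrigues using False by simp
next
  case True
  then show ?thesis
    by (simp add: so3_exp_0) (simp add: trace_def so3_entries)
qed

lemma vee_so3_exp: "vee (so3_exp e) = (sin (norm e) / norm e) *\<^sub>R e"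
  unfolding so3_exp_rodrigues by (simp add: vee_def so3_entries algebra_simps)

lemma trace_cross_matrix_so3_exp:
  "trace (cross_matrix \<xi> ** so3_exp e) = - 2 * (sin (norm e) / norm e) * (e \<bullet> \<xi>)"
proof -
  have "trace (cross_matrix \<xi> ** (mat 1 + a *\<^sub>R cross_matrix e + b *\<^sub>R (cross_matrix e ** cross_matrix e)))
      = - 2 * a * (e \<bullet> \<xi>)" for a b
    by (simp add: trace_def so3_entries algebra_simps)
  then show ?thesis
    unfolding so3_exp_rodrigues .
qed

lemma vee_cross_matrix_so3_exp:
  "vee (cross_matrix \<xi> ** so3_exp e) = \<xi> - (sin (norm e) / norm e / 2) *\<^sub>R cross3 e \<xi>
     - ((1 - cos (norm e)) / (norm e)\<^sup>2 / 2) *\<^sub>R ((e \<bullet> e) *\<^sub>R \<xi> + (e \<bullet> \<xi>) *\<^sub>R e)"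
proof -
  have "vee (cross_matrix \<xi> ** (mat 1 + a *\<^sub>R cross_matrix e + b *\<^sub>R (cross_matrix e ** cross_matrix e)))
      = \<xi> - (a / 2) *\<^sub>R cross3 e \<xi> - (b / 2) *\<^sub>R ((e \<bullet> e) *\<^sub>R \<xi> + (e \<bullet> \<xi>) *\<^sub>R e)" for a b
    by (simp add: vee_def so3_entries)
      (simp add: algebra_simps add_divide_distrib diff_divide_distrib)
  then show ?thesis
    unfolding so3_exp_rodrigues .
qed

lemma cross3_cross3_same: "cross3 e (cross3 e \<xi>) = (e \<bullet> \<xi>) *\<^sub>R e - (e \<bullet> e) *\<^sub>R \<xi>"
  by (simp add: so3_entries algebra_simps)

lemma norm_cross3_le: "norm (cross3 a b) \<le> norm a * norm b"
proof (rule power2_le_imp_le)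
  show "(norm (cross3 a b))\<^sup>2 \<le> (norm a * norm b)\<^sup>2"
    using norm_cross_dot[of a b] zero_le_power2[of "a \<bullet> b"] by linarith
qed simp

lemma has_vector_derivative_iff_tendsto:
  "(f has_vector_derivative D) (at x) \<longleftrightarrow> ((\<lambda>s. (f s - f x) /\<^sub>R (s - x)) \<longlongrightarrow> D) (at x)"
proof -
  have "(f has_vector_derivative D) (at x) \<longleftrightarrow>
      ((\<lambda>s. norm (f s - f x - (s - x) *\<^sub>R D) / norm (s - x)) \<longlongrightarrow> 0) (at x)"
    unfolding has_vector_derivative_def has_derivative_iff_norm
    by (simp add: bounded_linear_scaleR_left)
  also have "\<dots> \<longleftrightarrow> ((\<lambda>s. norm ((f s - f x) /\<^sub>R (s - x) - D)) \<longlongrightarrow> 0) (at x)"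
  proof (rule tendsto_cong)
    have "norm (f s - f x - (s - x) *\<^sub>R D) / norm (s - x) = norm ((f s - f x) /\<^sub>R (s - x) - D)"
      if "s \<noteq> x" for s
    proof -
      have "(f s - f x) /\<^sub>R (s - x) - D = (f s - f x - (s - x) *\<^sub>R D) /\<^sub>R (s - x)"
        using that by (simp add: scaleR_diff_right)
      then show ?thesis
        by (simp add: divide_inverse mult.commute)
    qed
    then show "\<forall>\<^sub>F s in at x. norm (f s - f x - (s - x) *\<^sub>R D) / norm (s - x)
        = norm ((f s - f x) /\<^sub>R (s - x) - D)"
      by (simp add: eventually_at_filter)
  qed
  finally show ?thesis
    by (simp add: tendsto_norm_zero_iff LIM_zero_iff)
qed

lemma x_cot_bound:
  fixes x :: real
  assumes "0 < x" "x < pi / 2"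
  shows "\<bar>1 - x * cos x / sin x - x\<^sup>2 / 3\<bar> \<le> x ^ 3"
proof -
  have "pi / 2 < 1.6"
    using pi_approx by simp
  then have x: "x < 1.6" "x > 0"
    using assms by linarith+
  have "x * x \<le> 1.6 * 1.6"
    using x by (intro mult_mono) auto
  then have x2: "x\<^sup>2 \<le> 2.56"
    by (simp add: power2_eq_square)
  have s: "\<bar>sin x - (x - x ^ 3 / 6)\<bar> \<le> x ^ 5 / 120"
    using Maclaurin_sin_bound[of x 5] x
    by (simp add: sin_coeff_def lessThan_nat_numeral fact_numeral field_simps)
  have c: "\<bar>cos x - (1 - x\<^sup>2 / 2)\<bar> \<le> x ^ 4 / 24"
  proof -
    obtain t where "cos x = (\<Sum>m<4. cos_coeff m * x ^ m) + (cos (t + 1/2 * real 4 * pi) / fact 4) * x ^ 4"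
      using Maclaurin_cos_expansion[of x 4] by auto
    then have "\<bar>cos x - (1 - x\<^sup>2 / 2)\<bar> = \<bar>cos (t + 2 * pi)\<bar> * (x ^ 4 / 24)"
      by (simp add: cos_coeff_def lessThan_nat_numeral fact_numeral abs_mult)
    also have "\<dots> \<le> 1 * (x ^ 4 / 24)"
      by (intro mult_right_mono) auto
    finally show ?thesis by simp
  qed
  have c': "\<bar>x * cos x - (x - x ^ 3 / 2)\<bar> \<le> x ^ 5 / 24"
  proof -
    have "x * cos x - (x - x ^ 3 / 2) = x * (cos x - (1 - x\<^sup>2 / 2))"
      by (simp add: algebra_simps power3_eq_cube power2_eq_square)
    then have "\<bar>x * cos x - (x - x ^ 3 / 2)\<bar> = x * \<bar>cos x - (1 - x\<^sup>2 / 2)\<bar>"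
      using x by (simp add: abs_mult)
    also have "\<dots> \<le> x * (x ^ 4 / 24)"
      using c x by (intro mult_left_mono) auto
    finally show ?thesis
      by (simp add: eval_nat_numeral)
  qed
  have s': "\<bar>x\<^sup>2 * sin x / 3 - (x ^ 3 / 3 - x ^ 5 / 18)\<bar> \<le> x ^ 5 / 100"
  proof -
    have *: "x\<^sup>2 * sin x / 3 - (x ^ 3 / 3 - x ^ 5 / 18) = x\<^sup>2 / 3 * (sin x - (x - x ^ 3 / 6))"
      by (simp add: algebra_simps eval_nat_numeral)
    have "\<bar>x\<^sup>2 * sin x / 3 - (x ^ 3 / 3 - x ^ 5 / 18)\<bar> = x\<^sup>2 / 3 * \<bar>sin x - (x - x ^ 3 / 6)\<bar>"
      unfolding * abs_mult by simp
    also have "\<dots> \<le> 2.56 / 3 * (x ^ 5 / 120)"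
      using s x x2 by (intro mult_mono) auto
    also have "\<dots> \<le> x ^ 5 / 100"
      using x by simp
    finally show ?thesis .
  qed
  have "\<bar>sin x - x * cos x - x\<^sup>2 * sin x / 3\<bar> \<le> x ^ 5 / 8"
  proof -
    have "x ^ 5 \<ge> 0"
      using x by simp
    then show ?thesis
      using s c' s' unfolding abs_le_iff by linarith
  qed
  also have "\<dots> \<le> x ^ 3 * (x / 2)"
  proof -
    have "x ^ 5 / 8 = x ^ 3 * (x * (x / 8))"
      by (simp add: eval_nat_numeral)
    also have "\<dots> \<le> x ^ 3 * (x * (1 / 2))"
      using x by (intro mult_left_mono) auto
    finally show ?thesis by simp
  qed
  also have "\<dots> \<le> x ^ 3 * sin x"
  proof -
    have "x ^ 3 / 6 + x ^ 5 / 120 = x * (x\<^sup>2 * (1 / 6 + x\<^sup>2 / 120))"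
      by (simp add: algebra_simps eval_nat_numeral)
    also have "\<dots> \<le> x * (2.56 * (1 / 6 + 2.56 / 120))"
      using x x2 by (intro mult_left_mono mult_mono add_left_mono divide_right_mono) auto
    also have "\<dots> \<le> x * (1 / 2)"
      using x by (intro mult_left_mono) auto
    finally have "x / 2 \<le> sin x"
      using s by linarith
    then show ?thesis
      using x by (intro mult_left_mono) auto
  qed
  finally have *: "\<bar>sin x - x * cos x - x\<^sup>2 * sin x / 3\<bar> \<le> x ^ 3 * sin x" .
  have sin: "sin x > 0"
    using assms by (intro sin_gt_zero) auto
  have "1 - x * cos x / sin x - x\<^sup>2 / 3 = (sin x - x * cos x - x\<^sup>2 * sin x / 3) / sin x"
    using sin by (simp add: diff_divide_distrib)
  then have "\<bar>1 - x * cos x / sin x - x\<^sup>2 / 3\<bar> = \<bar>sin x - x * cos x - x\<^sup>2 * sin x / 3\<bar> / sin x"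
    using sin by (simp only: abs_divide abs_of_pos)
  also have "\<dots> \<le> x ^ 3"
    using * unfolding pos_divide_le_eq[OF sin] .
  finally show ?thesis .
qed

lemma has_vector_derivative_unique_along:
  fixes f g :: "real \<Rightarrow> 'a::real_normed_vector"
  assumes "(f has_vector_derivative f') (at x)" "(g has_vector_derivative g') (at x)"
    and "filterlim \<tau> (at x) sequentially" "\<And>j::nat. f (\<tau> j) = g (\<tau> j)" "f x = g x"
  shows "f' = g'"
proof -
  have "(\<lambda>j. (f (\<tau> j) - f x) /\<^sub>R (\<tau> j - x)) \<longlonglongrightarrow> f'"
    using assms(1,3) unfolding has_vector_derivative_iff_tendsto by (rule filterlim_compose)
  moreover have "(\<lambda>j. (g (\<tau> j) - g x) /\<^sub>R (\<tau> j - x)) \<longlonglongrightarrow> g'"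
    using assms(2,3) unfolding has_vector_derivative_iff_tendsto by (rule filterlim_compose)
  ultimately show ?thesis
    using assms(4,5) LIMSEQ_unique by (metis (no_types, lifting) ext)
qed

text \<open>The left-trivialised derivative of the logarithm, obtained from the trace and the
  skew-symmetric part of \<open>so3_exp (e s)\<close>.  The identity between exponentials is only required along
  a sequence of times, so openness of the domain of the logarithm is not needed.\<close>

lemma log_velocity:
  fixes e :: "real \<Rightarrow> real^3"
  assumes e: "(e has_vector_derivative v) (at 0)" and lt: "norm (e 0) < pi" "e 0 \<noteq> 0"
    and \<tau>: "filterlim \<tau> (at 0) sequentially"
    and eq: "\<And>j. so3_exp (e (\<tau> j)) = so3_exp (\<tau> j *\<^sub>R \<xi>) ** so3_exp (e 0)"
  defines "\<theta> \<equiv> norm (e 0)"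
  defines "\<gamma> \<equiv> \<theta> * (1 + cos \<theta>) / (2 * sin \<theta>)"
  shows "v = \<xi> - (1 / 2) *\<^sub>R cross3 (e 0) \<xi> + ((1 - \<gamma>) / \<theta>\<^sup>2) *\<^sub>R cross3 (e 0) (cross3 (e 0) \<xi>)"
proof -
  define M where "M = so3_exp (e 0)"
  define p where "p = e 0 \<bullet> \<xi>"
  have \<theta>: "\<theta> > 0" "sin \<theta> > 0"
    using lt by (auto simp: \<theta>_def intro!: sin_gt_zero)
  have \<theta>2: "e 0 \<bullet> e 0 = \<theta>\<^sup>2"
    by (simp add: \<theta>_def power2_norm_eq_inner)
  have D: "((\<lambda>s. so3_exp (s *\<^sub>R \<xi>) ** M) has_vector_derivative cross_matrix \<xi> ** M) (at 0)"
    by (rule bounded_linear.has_vector_derivative[OF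
          bounded_bilinear.bounded_linear_left[OF bounded_bilinear_matrix_mult]
          has_vector_derivative_so3_exp_line])
  have N: "((\<lambda>s. norm (e s)) has_real_derivative (e 0 \<bullet> v) / \<theta>) (at 0)"
  proof -
    have "((\<lambda>s. e s \<bullet> e s) has_real_derivative e 0 \<bullet> v + v \<bullet> e 0) (at 0)"
      unfolding has_real_derivative_iff_has_vector_derivative
      by (rule bounded_bilinear.has_vector_derivative[OF bounded_bilinear_inner e e])
    moreover have "e 0 \<bullet> e 0 > 0"
      using lt by simp
    ultimately have "((\<lambda>s. sqrt (e s \<bullet> e s)) has_real_derivative
        inverse (sqrt (e 0 \<bullet> e 0)) / 2 * (e 0 \<bullet> v + v \<bullet> e 0)) (at 0)"
      by (intro DERIV_chain2[OF DERIV_real_sqrt])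
    moreover have "inverse (sqrt (e 0 \<bullet> e 0)) / 2 * (e 0 \<bullet> v + v \<bullet> e 0) = (e 0 \<bullet> v) / \<theta>"
      unfolding \<theta>_def norm_eq_sqrt_inner[of "e 0"] by (simp only: inner_commute[of v] divide_inverse) simp
    ultimately show ?thesis
      unfolding norm_eq_sqrt_inner by (simp only:)
  qed
  have "- 2 * sin \<theta> * ((e 0 \<bullet> v) / \<theta>) = trace (cross_matrix \<xi> ** M)"
  proof (rule has_vector_derivative_unique_along[OF _ _ \<tau>])
    show "((\<lambda>s. 1 + 2 * cos (norm (e s))) has_vector_derivative - 2 * sin \<theta> * ((e 0 \<bullet> v) / \<theta>)) (at 0)"
      unfolding has_real_derivative_iff_has_vector_derivative[symmetric]
      by (auto intro!: derivative_eq_intros N simp: \<theta>_def)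
    show "((\<lambda>s. trace (so3_exp (s *\<^sub>R \<xi>) ** M)) has_vector_derivative trace (cross_matrix \<xi> ** M)) (at 0)"
      by (rule bounded_linear.has_vector_derivative[OF bounded_linear_trace D])
  qed (simp_all add: eq[symmetric] trace_so3_exp[symmetric] M_def so3_exp_0)
  then have ev: "e 0 \<bullet> v = p"
    using \<theta> unfolding M_def trace_cross_matrix_so3_exp \<theta>_def[symmetric] p_def by (simp add: field_simps)
  have "(sin \<theta> / \<theta>) *\<^sub>R v + ((cos \<theta> * (p / \<theta>) * \<theta> - sin \<theta> * (p / \<theta>)) / \<theta>\<^sup>2) *\<^sub>R e 0
      = vee (cross_matrix \<xi> ** M)"
  proof (rule has_vector_derivative_unique_along[OF _ _ \<tau>])
    have "((\<lambda>s. sin (norm (e s)) / norm (e s)) has_real_derivative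
        ((cos \<theta> * (p / \<theta>) * \<theta> - sin \<theta> * (p / \<theta>)) / \<theta>\<^sup>2)) (at 0)"
      using \<theta> by (auto intro!: derivative_eq_intros N simp: \<theta>_def ev power2_eq_square)
    from has_vector_derivative_scaleR[OF this e]
    show "((\<lambda>s. (sin (norm (e s)) / norm (e s)) *\<^sub>R e s) has_vector_derivative
        (sin \<theta> / \<theta>) *\<^sub>R v + ((cos \<theta> * (p / \<theta>) * \<theta> - sin \<theta> * (p / \<theta>)) / \<theta>\<^sup>2) *\<^sub>R e 0) (at 0)"
      unfolding \<theta>_def .
    show "((\<lambda>s. vee (so3_exp (s *\<^sub>R \<xi>) ** M)) has_vector_derivative vee (cross_matrix \<xi> ** M)) (at 0)"
      by (rule bounded_linear.has_vector_derivative[OF bounded_linear_vee D])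
  qed (simp_all add: eq[symmetric] vee_so3_exp[symmetric] M_def so3_exp_0)
  also have "\<dots> = \<xi> - (sin \<theta> / \<theta> / 2) *\<^sub>R cross3 (e 0) \<xi>
     - ((1 - cos \<theta>) / \<theta>\<^sup>2 / 2) *\<^sub>R (\<theta>\<^sup>2 *\<^sub>R \<xi> + p *\<^sub>R e 0)"
    unfolding M_def vee_cross_matrix_so3_exp \<theta>_def[symmetric] p_def \<theta>2 ..
  finally have "(sin \<theta> / \<theta>) *\<^sub>R v = \<xi> - (sin \<theta> / \<theta> / 2) *\<^sub>R cross3 (e 0) \<xi>
     - ((1 - cos \<theta>) / \<theta>\<^sup>2 / 2) *\<^sub>R (\<theta>\<^sup>2 *\<^sub>R \<xi> + p *\<^sub>R e 0)
     - ((cos \<theta> * (p / \<theta>) * \<theta> - sin \<theta> * (p / \<theta>)) / \<theta>\<^sup>2) *\<^sub>R e 0"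
    by (simp add: algebra_simps)
  also have "\<dots> = (sin \<theta> / \<theta>) *\<^sub>R
      (\<xi> - (1 / 2) *\<^sub>R cross3 (e 0) \<xi> + ((1 - \<gamma>) / \<theta>\<^sup>2) *\<^sub>R (p *\<^sub>R e 0 - \<theta>\<^sup>2 *\<^sub>R \<xi>))"
    (is "?L = ?R")
  proof -
    define \<kappa> where "\<kappa> = sin \<theta> / \<theta> * ((1 - \<gamma>) / \<theta>\<^sup>2)"
    have 1: "\<kappa> * \<theta>\<^sup>2 = sin \<theta> / \<theta> - (1 - (1 - cos \<theta>) / 2)"
      using \<theta> by (simp add: \<kappa>_def \<gamma>_def field_simps)
    have 0: "\<kappa> = (sin \<theta> / \<theta> - (1 - (1 - cos \<theta>) / 2)) / \<theta>\<^sup>2"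
      using \<theta> unfolding 1[symmetric] by simp
    have 2: "\<kappa> * p = - ((1 - cos \<theta>) / \<theta>\<^sup>2 / 2 * p) - (cos \<theta> * (p / \<theta>) * \<theta> - sin \<theta> * (p / \<theta>)) / \<theta>\<^sup>2"
      unfolding 0 using \<theta> by (simp add: field_simps)
    have 3: "(1 - cos \<theta>) / \<theta>\<^sup>2 / 2 * \<theta>\<^sup>2 = (1 - cos \<theta>) / 2"
      using \<theta> by simp
    have "?R = (sin \<theta> / \<theta>) *\<^sub>R \<xi> - (sin \<theta> / \<theta> / 2) *\<^sub>R cross3 (e 0) \<xi> + (\<kappa> * p) *\<^sub>R e 0 - (\<kappa> * \<theta>\<^sup>2) *\<^sub>R \<xi>"
      unfolding \<kappa>_def by (simp only: scaleR_add_right scaleR_diff_right scaleR_scaleR) (simp add: mult.assoc)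
    also have "\<dots> = ?L"
      unfolding 1 2 scaleR_add_right scaleR_scaleR 3 scaleR_diff_left scaleR_minus_left by simp
    finally show ?thesis ..
  qed
  finally show ?thesis
    unfolding cross3_cross3_same p_def[symmetric] \<theta>2 using \<theta> by simp
qed

lemma log_velocity_0:
  fixes e :: "real \<Rightarrow> real^3"
  assumes e: "(e has_vector_derivative v) (at 0)" and e0: "e 0 = 0"
    and \<tau>: "filterlim \<tau> (at 0) sequentially"
    and eq: "\<And>j. so3_exp (e (\<tau> j)) = so3_exp (\<tau> j *\<^sub>R \<xi>)"
  shows "v = \<xi>"
proof (rule LIMSEQ_unique)
  have "(\<lambda>j. vee (so3_exp (\<tau> j *\<^sub>R \<xi>)) /\<^sub>R \<tau> j) \<longlonglongrightarrow> vee (cross_matrix \<xi>)"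
  proof -
    have "((\<lambda>s. vee (so3_exp (s *\<^sub>R \<xi>))) has_vector_derivative vee (cross_matrix \<xi>)) (at 0)"
      by (rule bounded_linear.has_vector_derivative[OF bounded_linear_vee
            has_vector_derivative_so3_exp_line])
    then have "((\<lambda>s. vee (so3_exp (s *\<^sub>R \<xi>)) /\<^sub>R s) \<longlongrightarrow> vee (cross_matrix \<xi>)) (at 0)"
      unfolding has_vector_derivative_iff_tendsto by (simp only: scaleR_zero_left vee_so3_exp[of 0]) simp
    then show ?thesis
      using \<tau> by (rule filterlim_compose)
  qed
  moreover have "vee (cross_matrix \<xi>) = \<xi>"
    by (simp add: vee_def so3_entries)
  ultimately show "(\<lambda>j. vee (so3_exp (e (\<tau> j))) /\<^sub>R \<tau> j) \<longlonglongrightarrow> \<xi>"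
    by (simp add: eq)
  have "(e \<longlongrightarrow> 0) (at 0)"
    using has_vector_derivative_continuous[OF e] e0 by (simp add: isCont_def)
  then have "((\<lambda>s. norm (e s)) \<longlongrightarrow> 0) (at 0)"
    by (rule tendsto_norm_zero)
  then have "(\<lambda>j. norm (e (\<tau> j))) \<longlonglongrightarrow> 0"
    using \<tau> by (rule filterlim_compose)
  then have "(\<lambda>j. sinc (norm (e (\<tau> j)))) \<longlonglongrightarrow> sinc 0"
    by (rule isCont_tendsto_compose[OF isCont_sinc])
  moreover have "(\<lambda>j. e (\<tau> j) /\<^sub>R \<tau> j) \<longlonglongrightarrow> v"
    using filterlim_compose[OF e[unfolded has_vector_derivative_iff_tendsto] \<tau>] e0 by simp
  ultimately have "(\<lambda>j. sinc (norm (e (\<tau> j))) *\<^sub>R (e (\<tau> j) /\<^sub>R \<tau> j)) \<longlonglongrightarrow> sinc 0 *\<^sub>R v"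
    by (rule tendsto_scaleR)
  moreover have "sinc (norm (e (\<tau> j))) *\<^sub>R (e (\<tau> j) /\<^sub>R \<tau> j) = vee (so3_exp (e (\<tau> j))) /\<^sub>R \<tau> j" for j
    by (simp add: vee_so3_exp)
  ultimately show "(\<lambda>j. vee (so3_exp (e (\<tau> j))) /\<^sub>R \<tau> j) \<longlonglongrightarrow> v"
    by simp
qed

lemma log_velocity_bound:
  fixes e :: "real \<Rightarrow> real^3"
  assumes e: "(e has_vector_derivative v) (at 0)" and lt: "norm (e 0) < pi"
    and \<tau>: "filterlim \<tau> (at 0) sequentially"
    and eq: "\<And>j. so3_exp (e (\<tau> j)) = so3_exp (\<tau> j *\<^sub>R \<xi>) ** so3_exp (e 0)"
  shows "norm (v - (\<xi> - (1 / 2) *\<^sub>R cross3 (e 0) \<xi> + (1 / 12) *\<^sub>R cross3 (e 0) (cross3 (e 0) \<xi>)))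
    \<le> norm (e 0) ^ 3 * norm \<xi>"
proof (cases "e 0 = 0")
  case True
  then show ?thesis
    using log_velocity_0[OF e True \<tau>, of \<xi>] eq by (simp add: so3_exp_0)
next
  case False
  define \<theta> where "\<theta> = norm (e 0)"
  define \<gamma> where "\<gamma> = \<theta> * (1 + cos \<theta>) / (2 * sin \<theta>)"
  have \<theta>: "0 < \<theta>" "\<theta> < pi"
    using False lt by (auto simp: \<theta>_def)
  have v: "v = \<xi> - (1 / 2) *\<^sub>R cross3 (e 0) \<xi> + ((1 - \<gamma>) / \<theta>\<^sup>2) *\<^sub>R cross3 (e 0) (cross3 (e 0) \<xi>)"
    using log_velocity[OF e lt False \<tau> eq] by (simp add: \<theta>_def \<gamma>_def)
  have sc: "sin (\<theta> / 2) > 0" "cos (\<theta> / 2) > 0"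
    using \<theta> by (auto intro!: sin_gt_zero cos_gt_zero)
  have "\<gamma> = \<theta> / 2 * cos (\<theta> / 2) / sin (\<theta> / 2)"
    using sc sin_double[of "\<theta> / 2"] cos_double_cos[of "\<theta> / 2"]
    by (simp add: \<gamma>_def field_simps power2_eq_square)
  then have "\<bar>1 - \<gamma> - \<theta>\<^sup>2 / 12\<bar> \<le> (\<theta> / 2) ^ 3"
    using x_cot_bound[of "\<theta> / 2"] \<theta> by (simp add: power_divide)
  also have "\<dots> \<le> \<theta> ^ 3"
    using \<theta> by (intro power_mono) auto
  finally have b: "\<bar>1 - \<gamma> - \<theta>\<^sup>2 / 12\<bar> \<le> \<theta> ^ 3" .
  have "v - (\<xi> - (1 / 2) *\<^sub>R cross3 (e 0) \<xi> + (1 / 12) *\<^sub>R cross3 (e 0) (cross3 (e 0) \<xi>))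
      = ((1 - \<gamma> - \<theta>\<^sup>2 / 12) / \<theta>\<^sup>2) *\<^sub>R cross3 (e 0) (cross3 (e 0) \<xi>)"
    using \<theta> unfolding v by (simp add: diff_divide_distrib scaleR_diff_left)
  then have "norm (v - (\<xi> - (1 / 2) *\<^sub>R cross3 (e 0) \<xi> + (1 / 12) *\<^sub>R cross3 (e 0) (cross3 (e 0) \<xi>)))
      = \<bar>1 - \<gamma> - \<theta>\<^sup>2 / 12\<bar> / \<theta>\<^sup>2 * norm (cross3 (e 0) (cross3 (e 0) \<xi>))"
    by simp
  also have "\<dots> \<le> \<theta> ^ 3 / \<theta>\<^sup>2 * (\<theta> * (\<theta> * norm \<xi>))"
  proof (intro mult_mono divide_right_mono b)
    have "norm (cross3 (e 0) (cross3 (e 0) \<xi>)) \<le> \<theta> * norm (cross3 (e 0) \<xi>)"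
      using norm_cross3_le[of "e 0"] by (simp add: \<theta>_def)
    also have "\<dots> \<le> \<theta> * (\<theta> * norm \<xi>)"
      using norm_cross3_le[of "e 0" \<xi>] \<theta> by (intro mult_left_mono) (simp_all add: \<theta>_def)
    finally show "norm (cross3 (e 0) (cross3 (e 0) \<xi>)) \<le> \<theta> * (\<theta> * norm \<xi>)" .
  qed (use \<theta> in auto)
  also have "\<dots> = \<theta> ^ 3 * norm \<xi>"
    using \<theta> by (simp add: power2_eq_square)
  finally show ?thesis
    by (simp add: \<theta>_def)
qed

section \<open>Isotropic Gaussian vectors and product densities\<close>

lemma matrix_inv_eqI:
  fixes A B :: "real^'n^'n"
  assumes "A ** B = mat 1" "B ** A = mat 1"
  shows "matrix_inv A = B"
proof -
  have "A ** matrix_inv A = mat 1 \<and> matrix_inv A ** A = mat 1"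
    unfolding matrix_inv_def by (rule someI[of _ B]) (use assms in auto)
  then show ?thesis
    using assms by (metis matrix_mul_assoc matrix_mul_lid matrix_mul_rid)
qed

lemma gaussian_density_isotropic:
  assumes "\<sigma> > 0"
  shows "gaussian_density (\<sigma>\<^sup>2 *\<^sub>R mat 1) x = exp (- (norm x)\<^sup>2 / (2 * \<sigma>\<^sup>2)) / sqrt ((2 * pi * \<sigma>\<^sup>2) ^ 3)"
proof -
  have "matrix_inv (\<sigma>\<^sup>2 *\<^sub>R mat 1 :: real^3^3) = (1 / \<sigma>\<^sup>2) *\<^sub>R mat 1"
    using assms by (intro matrix_inv_eqI) (simp_all add: scaleR_matrix_mult)
  moreover have "det (\<sigma>\<^sup>2 *\<^sub>R mat 1 :: real^3^3) = (\<sigma>\<^sup>2) ^ 3"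
    by (simp add: det_3 mat_def power3_eq_cube)
  ultimately show ?thesis
    by (simp add: gaussian_density_def scaleR_matrix_vector_assoc[symmetric] power2_norm_eq_inner
        power_mult_distrib mult_ac)
qed

lemma gaussian_density_pos: "\<sigma> > 0 \<Longrightarrow> gaussian_density (\<sigma>\<^sup>2 *\<^sub>R mat 1) x > 0"
  by (simp add: gaussian_density_isotropic)

lemma borel_measurable_gaussian_density: "gaussian_density S \<in> borel_measurable borel"
  unfolding gaussian_density_def
  by (intro borel_measurable_divide borel_measurable_const borel_measurable_continuous_onI continuous_intros)
    auto

lemma gaussian_density_normal_density:
  assumes "\<sigma> > 0"
  shows "gaussian_density (\<sigma>\<^sup>2 *\<^sub>R mat 1) x = (\<Prod>b\<in>Basis. normal_density 0 \<sigma> (x \<bullet> b))"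
proof -
  have "(norm x)\<^sup>2 = (\<Sum>b\<in>Basis. (x \<bullet> b)\<^sup>2)"
    unfolding power2_norm_eq_inner by (subst euclidean_inner) (simp add: power2_eq_square)
  then have "exp (- (norm x)\<^sup>2 / (2 * \<sigma>\<^sup>2)) = (\<Prod>b\<in>Basis. exp (- (x \<bullet> b)\<^sup>2 / (2 * \<sigma>\<^sup>2)))"
    by (simp add: exp_sum[symmetric] sum_negf sum_divide_distrib)
  then show ?thesis
    using assms
    by (simp add: gaussian_density_isotropic normal_density_def prod_dividef real_sqrt_power power_divide)
qed

lemma lborel_product_integral:
  fixes f :: "'a::euclidean_space \<Rightarrow> real \<Rightarrow> real"
  assumes f: "\<And>b. b \<in> Basis \<Longrightarrow> integrable lborel (f b)"
  shows "has_bochner_integral lborel (\<lambda>x. \<Prod>b\<in>Basis. f b (x \<bullet> b)) (\<Prod>b\<in>Basis. \<integral>x. f b x \<partial>lborel)"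
proof -
  interpret product_sigma_finite "\<lambda>_::'a. lborel :: real measure" ..
  have [measurable]: "f b \<in> borel_measurable borel" if "b \<in> Basis" for b
    using borel_measurable_integrable[OF f[OF that]] by simp
  have "has_bochner_integral (\<Pi>\<^sub>M b\<in>Basis. lborel) (\<lambda>x. \<Prod>b\<in>Basis. f b (x b)) (\<Prod>b\<in>Basis. \<integral>x. f b x \<partial>lborel)"
    using f by (simp add: has_bochner_integral_iff product_integral_prod product_integrable_prod)
  also have "(\<lambda>x. \<Prod>b\<in>Basis. f b (x b)) = (\<lambda>x. \<Prod>b\<in>Basis. f b ((\<Sum>c\<in>Basis. x c *\<^sub>R c) \<bullet> b))"
    by (simp cong: prod.cong)
  finally have "has_bochner_integral (distr (\<Pi>\<^sub>M b\<in>Basis. lborel) borel (\<lambda>x. \<Sum>b\<in>Basis. x b *\<^sub>R b))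
      (\<lambda>x. \<Prod>b\<in>Basis. f b (x \<bullet> b)) (\<Prod>b\<in>Basis. \<integral>x. f b x \<partial>lborel)"
    by (intro has_bochner_integral_distr) (auto intro!: borel_measurable_prod)
  then show ?thesis
    by (simp add: lborel_eq[symmetric])
qed

lemma normal_density_second_moment:
  assumes "\<sigma> > 0"
  shows "has_bochner_integral lborel (\<lambda>x. normal_density 0 \<sigma> x * (x * x)) (\<sigma>\<^sup>2)"
  using normal_moment_even[OF assms, of 0 1] by (simp add: power2_eq_square)

lemma gaussian_density_moments:
  fixes a :: "real^3"
  assumes \<sigma>: "\<sigma> > 0"
  shows "has_bochner_integral lborel (\<lambda>x. gaussian_density (\<sigma>\<^sup>2 *\<^sub>R mat 1) x * (a \<bullet> x)) 0"
    and "has_bochner_integral lborel (\<lambda>x. gaussian_density (\<sigma>\<^sup>2 *\<^sub>R mat 1) x * (a \<bullet> x)\<^sup>2) (\<sigma>\<^sup>2 * (norm a)\<^sup>2)"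
proof -
  let ?g = "gaussian_density (\<sigma>\<^sup>2 *\<^sub>R mat 1)"
  let ?n = "normal_density 0 \<sigma>"
  have n1: "has_bochner_integral lborel (\<lambda>x. ?n x * x) 0"
    using normal_moment_nz_1[OF \<sigma>, of 0] .
  note n2 = normal_density_second_moment[OF \<sigma>]
  have 1: "has_bochner_integral lborel (\<lambda>x. ?g x * (x \<bullet> b)) 0" if b: "b \<in> Basis" for b
  proof -
    let ?f = "\<lambda>c x. ?n x * (if c = b then x else 1)"
    have "has_bochner_integral lborel (\<lambda>x::real^3. \<Prod>c\<in>Basis. ?f c (x \<bullet> c)) (\<Prod>c\<in>Basis. \<integral>x. ?f c x \<partial>lborel)"
    proof (rule lborel_product_integral)
      show "integrable lborel (?f c)" for c
        by (cases "c = b") (use \<sigma> n1 in \<open>auto simp: has_bochner_integral_iff\<close>)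
    qed
    moreover have "(\<Prod>c\<in>Basis. \<integral>x. ?f c x \<partial>lborel) = 0"
      using b n1 by (auto simp: has_bochner_integral_iff intro!: bexI[of _ b])
    moreover have "(\<Prod>c\<in>Basis. ?f c (x \<bullet> c)) = ?g x * (x \<bullet> b)" for x
      using b by (simp add: prod.distrib gaussian_density_normal_density[OF \<sigma>] prod.delta)
    ultimately show ?thesis
      by simp
  qed
  have 2: "has_bochner_integral lborel (\<lambda>x. ?g x * ((x \<bullet> b) * (x \<bullet> c))) (if b = c then \<sigma>\<^sup>2 else 0)"
    if b: "b \<in> Basis" "c \<in> Basis" for b c
  proof -
    let ?f = "\<lambda>d x. ?n x * ((if d = b then x else 1) * (if d = c then x else 1))"
    have "has_bochner_integral lborel (\<lambda>x::real^3. \<Prod>d\<in>Basis. ?f d (x \<bullet> d)) (\<Prod>d\<in>Basis. \<integral>x. ?f d x \<partial>lborel)"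
    proof (rule lborel_product_integral)
      show "integrable lborel (?f d)" for d
        by (cases "d = b"; cases "d = c") (use \<sigma> n1 n2 in \<open>auto simp: has_bochner_integral_iff\<close>)
    qed
    moreover have "(\<Prod>d\<in>Basis. \<integral>x. ?f d x \<partial>lborel) = (if b = c then \<sigma>\<^sup>2 else 0)"
    proof (cases "b = c")
      case True
      have "(\<integral>x. ?f d x \<partial>lborel) = (if d = b then \<sigma>\<^sup>2 else 1)" for d
        using True \<sigma> n2 by (auto simp: has_bochner_integral_iff)
      then show ?thesis
        using True b by (simp add: prod.delta)
    next
      case False
      then show ?thesis
        using b n1 by (auto simp: has_bochner_integral_iff intro!: bexI[of _ b])
    qed
    moreover have "(\<Prod>d\<in>Basis. ?f d (x \<bullet> d)) = ?g x * ((x \<bullet> b) * (x \<bullet> c))" for x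
      using b by (simp add: prod.distrib gaussian_density_normal_density[OF \<sigma>] prod.delta)
    ultimately show ?thesis
      by simp
  qed
  have ax: "a \<bullet> x = (\<Sum>b\<in>Basis. (a \<bullet> b) * (x \<bullet> b))" for x
    by (rule euclidean_inner)
  have "has_bochner_integral lborel (\<lambda>x. \<Sum>b\<in>Basis. (a \<bullet> b) * (?g x * (x \<bullet> b))) (\<Sum>b\<in>Basis. (a \<bullet> b) * 0)"
    by (intro has_bochner_integral_sum has_bochner_integral_mult_right 1)
  moreover have "(\<Sum>b\<in>Basis. (a \<bullet> b) * (?g x * (x \<bullet> b))) = ?g x * (a \<bullet> x)" for x
    unfolding ax[of x] sum_distrib_left by (intro sum.cong refl) (simp only: mult_ac)
  ultimately show "has_bochner_integral lborel (\<lambda>x. ?g x * (a \<bullet> x)) 0"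
    by simp
  have "has_bochner_integral lborel (\<lambda>x. \<Sum>b\<in>Basis. \<Sum>c\<in>Basis. ((a \<bullet> b) * (a \<bullet> c)) * (?g x * ((x \<bullet> b) * (x \<bullet> c))))
      (\<Sum>b\<in>Basis. \<Sum>c\<in>Basis. ((a \<bullet> b) * (a \<bullet> c)) * (if b = c then \<sigma>\<^sup>2 else 0))"
    by (intro has_bochner_integral_sum has_bochner_integral_mult_right 2)
  moreover have "(\<Sum>b\<in>Basis. \<Sum>c\<in>Basis. ((a \<bullet> b) * (a \<bullet> c)) * (if b = c then \<sigma>\<^sup>2 else 0)) = \<sigma>\<^sup>2 * (norm a)\<^sup>2"
  proof -
    have "((a \<bullet> b) * (a \<bullet> c)) * (if b = c then \<sigma>\<^sup>2 else 0) = (if b = c then \<sigma>\<^sup>2 * ((a \<bullet> b) * (a \<bullet> b)) else 0)" for b c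
      by simp
    then show ?thesis
      unfolding power2_norm_eq_inner euclidean_inner[of a a] by (simp add: sum_distrib_left)
  qed
  moreover have "(\<Sum>b\<in>Basis. \<Sum>c\<in>Basis. ((a \<bullet> b) * (a \<bullet> c)) * (?g x * ((x \<bullet> b) * (x \<bullet> c)))) = ?g x * (a \<bullet> x)\<^sup>2" for x
  proof -
    have "(a \<bullet> x)\<^sup>2 = (\<Sum>b\<in>Basis. \<Sum>c\<in>Basis. ((a \<bullet> b) * (x \<bullet> b)) * ((a \<bullet> c) * (x \<bullet> c)))"
      unfolding ax[of x] power2_eq_square sum_product ..
    then show ?thesis
      unfolding sum_distrib_left by (simp only: sum_distrib_left) (intro sum.cong refl; simp only: mult_ac)
  qed
  ultimately show "has_bochner_integral lborel (\<lambda>x. ?g x * (a \<bullet> x)\<^sup>2) (\<sigma>\<^sup>2 * (norm a)\<^sup>2)"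
    by simp
qed

lemma (in prob_space) second_moment_sum_indep_centered:
  fixes X :: "'i \<Rightarrow> 'a \<Rightarrow> real"
  assumes I: "finite I" and indep: "indep_vars (\<lambda>_. borel) X I"
    and X: "\<And>i. i \<in> I \<Longrightarrow> integrable M (X i)" "\<And>i. i \<in> I \<Longrightarrow> expectation (X i) = 0"
    and X2: "\<And>i. i \<in> I \<Longrightarrow> integrable M (\<lambda>x. (X i x)\<^sup>2)"
  shows "integrable M (\<lambda>x. (\<Sum>i\<in>I. X i x)\<^sup>2)"
    and "expectation (\<lambda>x. (\<Sum>i\<in>I. X i x)\<^sup>2) = (\<Sum>i\<in>I. expectation (\<lambda>x. (X i x)\<^sup>2))"
proof -
  have *: "integrable M (\<lambda>x. X i x * X j x) \<and>
      expectation (\<lambda>x. X i x * X j x) = (if i = j then expectation (\<lambda>x. (X i x)\<^sup>2) else 0)"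
    if ij: "i \<in> I" "j \<in> I" for i j
  proof (cases "i = j")
    case True
    then show ?thesis
      using X2 ij by (simp add: power2_eq_square)
  next
    case False
    have "indep_vars (\<lambda>_. borel) X {i, j}"
      using ij by (intro indep_vars_subset[OF indep]) auto
    then show ?thesis
      using indep_vars_lebesgue_integral[of "{i, j}" X] indep_vars_integrable[of "{i, j}" X] X ij False
      by auto
  qed
  have sq: "(\<Sum>i\<in>I. X i x)\<^sup>2 = (\<Sum>i\<in>I. \<Sum>j\<in>I. X i x * X j x)" for x
    by (simp add: power2_eq_square sum_product)
  show "integrable M (\<lambda>x. (\<Sum>i\<in>I. X i x)\<^sup>2)"
    unfolding sq using * by (intro Bochner_Integration.integrable_sum) auto
  show "expectation (\<lambda>x. (\<Sum>i\<in>I. X i x)\<^sup>2) = (\<Sum>i\<in>I. expectation (\<lambda>x. (X i x)\<^sup>2))"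
    unfolding sq using * I by (simp add: Bochner_Integration.integral_sum Bochner_Integration.integrable_sum sum.delta)
qed

lemma distr_shift_density_lborel:
  fixes m :: "'a::euclidean_space"
  assumes [measurable]: "g \<in> borel_measurable borel"
  shows "distr (density lborel g) borel (\<lambda>v. v + m) = density lborel (\<lambda>y. g (y - m))"
proof -
  have "density lborel (\<lambda>y. g (y - m)) = density (distr lborel borel ((+) m)) (\<lambda>y. g (y - m))"
    by (simp add: lborel_distr_plus)
  also have "\<dots> = distr (density lborel (\<lambda>v. g (m + v - m))) borel ((+) m)"
    by (rule density_distr) auto
  finally show ?thesis
    by (simp add: add.commute[of _ m])
qed

lemma PiM_density:
  fixes f :: "'i \<Rightarrow> 'a \<Rightarrow> real"
  assumes I: "finite I" and M: "sigma_finite_measure M"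
    and f: "\<And>i. i \<in> I \<Longrightarrow> f i \<in> borel_measurable M" "\<And>i x. i \<in> I \<Longrightarrow> f i x \<ge> 0"
    and P: "\<And>i. i \<in> I \<Longrightarrow> prob_space (density M (f i))"
  shows "(\<Pi>\<^sub>M i\<in>I. density M (f i)) = density (\<Pi>\<^sub>M i\<in>I. M) (\<lambda>x. \<Prod>i\<in>I. f i (x i))"
proof -
  define N where "N i = (if i \<in> I then density M (f i) else M)" for i
  interpret N: product_sigma_finite N
    unfolding product_sigma_finite_def
  proof
    fix i
    show "sigma_finite_measure (N i)"
      by (cases "i \<in> I") (simp_all add: N_def M P prob_space_imp_sigma_finite)
  qed
  interpret M: product_sigma_finite "\<lambda>_::'i. M"
    unfolding product_sigma_finite_def using M ..
  have "density (\<Pi>\<^sub>M i\<in>I. M) (\<lambda>x. \<Prod>i\<in>I. f i (x i)) = PiM I N"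
  proof (rule N.PiM_eqI[OF I])
    show "sets (density (\<Pi>\<^sub>M i\<in>I. M) (\<lambda>x. \<Prod>i\<in>I. f i (x i))) = sets (PiM I N)"
      by (simp add: N_def cong: sets_PiM_cong)
    fix A assume A: "\<And>i. i \<in> I \<Longrightarrow> A i \<in> sets (N i)"
    then have A': "\<And>i. i \<in> I \<Longrightarrow> A i \<in> sets M"
      by (simp add: N_def)
    have mf: "(\<lambda>x. ennreal (\<Prod>i\<in>I. f i (x i))) \<in> borel_measurable (\<Pi>\<^sub>M i\<in>I. M)"
      using f(1) by (intro measurable_compose[OF _ measurable_ennreal] borel_measurable_prod
          measurable_compose[OF measurable_component_singleton])
    have "emeasure (density (\<Pi>\<^sub>M i\<in>I. M) (\<lambda>x. \<Prod>i\<in>I. f i (x i))) (Pi\<^sub>E I A)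
        = (\<integral>\<^sup>+x. ennreal (\<Prod>i\<in>I. f i (x i)) * indicator (Pi\<^sub>E I A) x \<partial>(\<Pi>\<^sub>M i\<in>I. M))"
      using mf A' I by (intro emeasure_density sets_PiM_I_finite)
    also have "\<dots> = (\<integral>\<^sup>+x. (\<Prod>i\<in>I. ennreal (f i (x i)) * indicator (A i) (x i)) \<partial>(\<Pi>\<^sub>M i\<in>I. M))"
    proof (rule nn_integral_cong)
      fix x assume "x \<in> space (\<Pi>\<^sub>M i\<in>I. M)"
      then have "x \<in> extensional I"
        by (simp add: space_PiM PiE_def)
      then have "indicator (Pi\<^sub>E I A) x = (\<Prod>i\<in>I. indicator (A i) (x i) :: ennreal)"
        using I by (auto simp: indicator_def PiE_def Pi_def)
      then show "ennreal (\<Prod>i\<in>I. f i (x i)) * indicator (Pi\<^sub>E I A) x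
          = (\<Prod>i\<in>I. ennreal (f i (x i)) * indicator (A i) (x i))"
        using f(2) by (simp add: prod.distrib prod_ennreal)
    qed
    also have "\<dots> = (\<Prod>i\<in>I. \<integral>\<^sup>+x. ennreal (f i x) * indicator (A i) x \<partial>M)"
      using f(1) A' by (intro M.product_nn_integral_prod I borel_measurable_times_ennreal
          borel_measurable_indicator measurable_compose[OF _ measurable_ennreal])
    also have "\<dots> = (\<Prod>i\<in>I. emeasure (N i) (A i))"
      using f(1) A' by (intro prod.cong) (simp_all add: N_def emeasure_density)
    finally show "emeasure (density (\<Pi>\<^sub>M i\<in>I. M) (\<lambda>x. \<Prod>i\<in>I. f i (x i))) (Pi\<^sub>E I A)
        = (\<Prod>i\<in>I. emeasure (N i) (A i))" .
  qed
  also have "PiM I N = (\<Pi>\<^sub>M i\<in>I. density M (f i))"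
    by (rule PiM_cong) (simp_all add: N_def)
  finally show ?thesis ..
qed

section \<open>A Cramer-Rao inequality with curvature terms\<close>

definition second_moment :: "'a measure \<Rightarrow> ('a \<Rightarrow> real^3) \<Rightarrow> real^3^3" where
  "second_moment M e = (\<integral>y. (\<chi> i j. e y $ i * e y $ j) \<partial>M)"

lemma outer_norm_le: "norm ((\<chi> i j. v $ i * v $ j) :: real^3^3) \<le> (norm v)\<^sup>2 * 9"
proof -
  have "norm ((\<chi> i j. v $ i * v $ j) :: real^3^3) \<le> (\<Sum>i\<in>UNIV. norm (((\<chi> i j. v $ i * v $ j) :: real^3^3) $ i))"
    unfolding norm_vec_def by (rule L2_set_le_sum) simp
  also have "\<dots> \<le> (\<Sum>i\<in>(UNIV::3 set). \<Sum>j\<in>(UNIV::3 set). \<bar>v $ i * v $ j\<bar>)"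
    by (intro sum_mono) (use norm_le_l1_cart[of "(\<chi> j. v $ _ * v $ j)::real^3"] in simp)
  also have "\<dots> \<le> (\<Sum>i\<in>(UNIV::3 set). \<Sum>j\<in>(UNIV::3 set). norm v * norm v)"
    unfolding abs_mult by (intro sum_mono mult_mono component_le_norm_cart) auto
  finally show ?thesis
    by (simp add: power2_eq_square)
qed

locale bounded_error = prob_space M for M :: "'a measure" +
  fixes e :: "'a \<Rightarrow> real^3" and B :: real
  assumes e_measurable [measurable]: "e \<in> borel_measurable M"
    and e_bounded: "AE y in M. norm (e y) \<le> B"
begin

lemma integrable_bounded_by:
  fixes f :: "'a \<Rightarrow> 'b::{banach, second_countable_topology}"
  assumes [measurable]: "f \<in> borel_measurable M" and "\<And>y. norm (e y) \<le> B \<Longrightarrow> norm (f y) \<le> C"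
  shows "integrable M f"
  by (rule integrable_const_bound[of _ C]) (use e_bounded assms in auto)

lemma second_moment_entries_measurable: "(\<lambda>y. (\<chi> i j. e y $ i * e y $ j) :: real^3^3) \<in> borel_measurable M"
proof -
  have "(\<lambda>v::real^3. (\<chi> i j. v $ i * v $ j) :: real^3^3) \<in> borel_measurable borel"
    by (intro borel_measurable_continuous_onI continuous_intros)
  then show ?thesis
    by (rule measurable_compose[OF e_measurable])
qed

lemma second_moment_integrable: "integrable M (\<lambda>y. (\<chi> i j. e y $ i * e y $ j) :: real^3^3)"
proof (rule integrable_bounded_by[OF second_moment_entries_measurable])
  show "norm ((\<chi> i j. e y $ i * e y $ j) :: real^3^3) \<le> B\<^sup>2 * 9" if "norm (e y) \<le> B" for y
    using outer_norm_le[of "e y"] power_mono[OF that norm_ge_zero, of 2] by linarith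
qed

lemma second_moment_apply:
  assumes "bounded_linear T"
  shows "T (second_moment M e) = (\<integral>y. T (\<chi> i j. e y $ i * e y $ j) \<partial>M)"
  unfolding second_moment_def using integral_bounded_linear[OF assms second_moment_integrable] ..

lemma second_moment_quadratic:
  "x \<bullet> (second_moment M e *v z) = expectation (\<lambda>y. (x \<bullet> e y) * (z \<bullet> e y))"
proof -
  have "bounded_linear (\<lambda>A::real^3^3. x \<bullet> (A *v z))"
    by (rule linear_conv_bounded_linear[THEN iffD1], rule linearI)
      (simp_all add: matrix_vector_mult_add_rdistrib inner_add_right scaleR_matrix_vector_assoc[symmetric])
  moreover have "x \<bullet> ((\<chi> i j. v $ i * v $ j) *v z) = (x \<bullet> v) * (z \<bullet> v)" for v :: "real^3"
    by (simp add: so3_entries algebra_simps)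
  ultimately show ?thesis
    using second_moment_apply[of "\<lambda>A. x \<bullet> (A *v z)"] by simp
qed

lemma trace_second_moment: "trace (second_moment M e) = expectation (\<lambda>y. e y \<bullet> e y)"
  using second_moment_apply[OF bounded_linear_trace] by (simp add: trace_def inner_vec_def)

lemma transpose_second_moment: "transpose (second_moment M e) = second_moment M e"
  using second_moment_apply[OF bounded_linear_transpose]
  by (simp add: second_moment_def transpose_def mult.commute)

text \<open>A Cramer-Rao inequality in which \<open>S\<close> plays the role of the score in direction \<open>u\<close>, and the
  differentiated unbiasedness identity is \<open>expectation W = 0\<close>.\<close>

lemma cramer_rao:
  assumes unbiased: "expectation e = 0"
    and S: "integrable M S" "integrable M (\<lambda>y. (S y)\<^sup>2)"
    and W: "integrable M W" "expectation W = 0"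
    and r: "AE y in M. norm (W y - S y *\<^sub>R e y -
        (u - (1 / 2) *\<^sub>R cross3 (e y) u + (1 / 12) *\<^sub>R cross3 (e y) (cross3 (e y) u)))
        \<le> norm (e y) ^ 3 * norm u"
  defines "P \<equiv> second_moment M e"
  shows "x \<bullet> (P *v x) - 2 * (x \<bullet> u) + (1 / 6) * (x \<bullet> ((trace P *\<^sub>R mat 1 - P) *v u))
    + expectation (\<lambda>y. (S y)\<^sup>2) \<ge> - 2 * (norm x * norm u * expectation (\<lambda>y. norm (e y) ^ 3))"
proof -
  have [measurable]: "S \<in> borel_measurable M" "W \<in> borel_measurable M"
    using S W by auto
  have int_e: "integrable M e"
    by (rule integrable_bounded_by[of _ B]) auto
  have int_ee: "integrable M (\<lambda>y. (a \<bullet> e y) * (b \<bullet> e y))" for a b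
  proof (rule integrable_bounded_by)
    fix y assume y: "norm (e y) \<le> B"
    have *: "\<bar>v \<bullet> e y\<bar> \<le> norm v * B" for v
      using Cauchy_Schwarz_ineq2[of v "e y"] mult_left_mono[OF y norm_ge_zero[of v]] by linarith
    show "norm ((a \<bullet> e y) * (b \<bullet> e y)) \<le> (norm a * B) * (norm b * B)"
      unfolding real_norm_def abs_mult by (intro mult_mono * order_trans[OF abs_ge_zero *] abs_ge_zero)
  qed measurable
  have int_n: "integrable M (\<lambda>y. e y \<bullet> e y)"
    by (rule integrable_bounded_by[of _ "B * B"])
      (auto simp: power2_norm_eq_inner[symmetric] power2_eq_square intro!: mult_mono intro: order_trans[OF norm_ge_zero])
  have int_3: "integrable M (\<lambda>y. norm (e y) ^ 3)"
    by (rule integrable_bounded_by[of _ "B ^ 3"]) (auto intro!: power_mono)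
  have int_Se: "integrable M (\<lambda>y. S y * (x \<bullet> e y))"
  proof (rule Bochner_Integration.integrable_bound)
    show "integrable M (\<lambda>y. (norm x * B) * S y)"
      using S by simp
    show "AE y in M. norm (S y * (x \<bullet> e y)) \<le> norm ((norm x * B) * S y)"
      using e_bounded
    proof eventually_elim
      fix y assume y: "norm (e y) \<le> B"
      have "\<bar>x \<bullet> e y\<bar> \<le> norm x * B"
        using Cauchy_Schwarz_ineq2[of x "e y"] mult_left_mono[OF y norm_ge_zero[of x]] by linarith
      then have "\<bar>x \<bullet> e y\<bar> \<le> \<bar>norm x * B\<bar>"
        by linarith
      then have "\<bar>S y\<bar> * \<bar>x \<bullet> e y\<bar> \<le> \<bar>S y\<bar> * \<bar>norm x * B\<bar>"
        by (intro mult_left_mono) auto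
      then show "norm (S y * (x \<bullet> e y)) \<le> norm ((norm x * B) * S y)"
        unfolding real_norm_def abs_mult by (simp only: mult_ac)
    qed
  qed measurable
  define c where "c y = x \<bullet> u - (1 / 2) * (cross3 u x \<bullet> e y)
      + (1 / 12) * ((u \<bullet> e y) * (x \<bullet> e y) - (e y \<bullet> e y) * (x \<bullet> u))" for y
  define r where "r y = x \<bullet> W y - S y * (x \<bullet> e y) - c y" for y
  have c: "integrable M c"
    unfolding c_def using int_e int_ee int_n
    by (intro Bochner_Integration.integrable_add Bochner_Integration.integrable_diff
        integrable_mult_right integrable_mult_left integrable_inner_right) auto
  have "expectation c = x \<bullet> u - (1 / 2) * (cross3 u x \<bullet> expectation e)
      + (1 / 12) * (expectation (\<lambda>y. (u \<bullet> e y) * (x \<bullet> e y)) - expectation (\<lambda>y. e y \<bullet> e y) * (x \<bullet> u))"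
    unfolding c_def using int_e int_ee int_n by (simp add: prob_space)
  also have "\<dots> = x \<bullet> u - (1 / 12) * (x \<bullet> ((trace P *\<^sub>R mat 1 - P) *v u))"
    unfolding P_def unbiased trace_second_moment matrix_vector_mult_diff_rdistrib inner_diff_right
      second_moment_quadratic scaleR_matrix_vector_assoc[symmetric]
    by (simp add: mult.commute) (simp add: field_simps)
  finally have Ec: "expectation c = x \<bullet> u - (1 / 12) * (x \<bullet> ((trace P *\<^sub>R mat 1 - P) *v u))" .
  have int_r: "integrable M r"
    unfolding r_def using c W int_Se by simp
  have "expectation r = x \<bullet> expectation W - expectation (\<lambda>y. S y * (x \<bullet> e y)) - expectation c"
    unfolding r_def using c W(1) int_Se by simp
  then have Er: "expectation (\<lambda>y. S y * (x \<bullet> e y)) = - expectation c - expectation r"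
    by (simp add: W)
  have rW: "r y = x \<bullet> (W y - S y *\<^sub>R e y -
        (u - (1 / 2) *\<^sub>R cross3 (e y) u + (1 / 12) *\<^sub>R cross3 (e y) (cross3 (e y) u)))" for y
    by (simp add: r_def c_def inner_diff_right inner_add_right cross3_cross3_same)
      (simp add: so3_entries algebra_simps)
  have "\<bar>expectation r\<bar> \<le> expectation (\<lambda>y. norm x * norm u * norm (e y) ^ 3)"
  proof (rule order_trans[OF integral_abs_bound integral_mono_AE])
    show "AE y in M. \<bar>r y\<bar> \<le> norm x * norm u * norm (e y) ^ 3"
      using r
    proof eventually_elim
      fix y assume y: "norm (W y - S y *\<^sub>R e y -
        (u - (1 / 2) *\<^sub>R cross3 (e y) u + (1 / 12) *\<^sub>R cross3 (e y) (cross3 (e y) u)))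
        \<le> norm (e y) ^ 3 * norm u" (is "norm ?v \<le> _")
      show "\<bar>r y\<bar> \<le> norm x * norm u * norm (e y) ^ 3"
        using Cauchy_Schwarz_ineq2[of x ?v] mult_left_mono[OF y norm_ge_zero[of x]]
        unfolding rW by (simp add: mult_ac)
    qed
  qed (use int_r int_3 in auto)
  then have Er': "\<bar>expectation r\<bar> \<le> norm x * norm u * expectation (\<lambda>y. norm (e y) ^ 3)"
    by simp
  have "0 \<le> expectation (\<lambda>y. (x \<bullet> e y + S y)\<^sup>2)"
    by simp
  also have "(\<lambda>y. (x \<bullet> e y + S y)\<^sup>2) = (\<lambda>y. (x \<bullet> e y) * (x \<bullet> e y) + 2 * (S y * (x \<bullet> e y)) + (S y)\<^sup>2)"
    by (simp add: power2_eq_square algebra_simps)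
  also have "expectation \<dots> = x \<bullet> (P *v x) + 2 * expectation (\<lambda>y. S y * (x \<bullet> e y)) + expectation (\<lambda>y. (S y)\<^sup>2)"
    using int_ee int_Se S by (simp add: P_def second_moment_quadratic)
  finally have "0 \<le> x \<bullet> (P *v x) + 2 * (- expectation c - expectation r) + expectation (\<lambda>y. (S y)\<^sup>2)"
    unfolding Er .
  moreover have "- expectation r \<le> norm x * norm u * expectation (\<lambda>y. norm (e y) ^ 3)"
    using Er' by linarith
  ultimately show ?thesis
    unfolding Ec by argo
qed

end

section \<open>The observation model\<close>

lemma attitude_trajectory_left_translate:
  assumes X: "attitude_trajectory T \<omega> X" and Y: "attitude_trajectory T \<omega> Y"
    and T: "convex T" and s: "s \<in> T" and \<tau>: "\<tau> \<in> T" and XY: "X \<tau> = U ** Y \<tau>"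
  shows "X s = U ** Y s"
proof -
  have orth: "orthogonal_matrix (Y r)" if "r \<in> T" for r
    using Y that by (simp add: attitude_trajectory_def rotation_matrix_def)
  have "((\<lambda>r. X r ** transpose (Y r)) has_vector_derivative 0) (at r within T)" if r: "r \<in> T" for r
  proof -
    have DX: "(X has_vector_derivative X r ** cross_matrix (\<omega> r)) (at r within T)"
      and DY: "(Y has_vector_derivative Y r ** cross_matrix (\<omega> r)) (at r within T)"
      using X Y r by (auto simp: attitude_trajectory_def)
    have "((\<lambda>r. X r ** transpose (Y r)) has_vector_derivative
        X r ** transpose (Y r ** cross_matrix (\<omega> r)) + (X r ** cross_matrix (\<omega> r)) ** transpose (Y r))
        (at r within T)"
      by (rule bounded_bilinear.has_vector_derivative[OF bounded_bilinear_matrix_mult DX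
            bounded_linear.has_vector_derivative[OF bounded_linear_transpose DY]])
    moreover have "X r ** transpose (Y r ** cross_matrix (\<omega> r))
        = - ((X r ** cross_matrix (\<omega> r)) ** transpose (Y r))"
      by (simp add: matrix_transpose_mul transpose_cross_matrix matrix_mul_assoc)
        (simp add: so3_entries algebra_simps)
    ultimately show ?thesis
      by simp
  qed
  then obtain C where C: "\<And>r. r \<in> T \<Longrightarrow> X r ** transpose (Y r) = C"
    using has_vector_derivative_zero_constant[OF T, of "\<lambda>r. X r ** transpose (Y r)"] by blast
  have "U = X \<tau> ** transpose (Y \<tau>)"
    using orth[OF \<tau>] by (simp add: XY orthogonal_matrix_def matrix_mul_assoc[symmetric])
  then have "X s ** transpose (Y s) = U"
    using C s \<tau> by simp
  then show ?thesis
    using orth[OF s] by (simp add: orthogonal_matrix matrix_mul_assoc[symmetric] flip: \<open>_ = U\<close>)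
qed

lemma finite_obs_index: "finite (obs_index n)"
  by (simp add: obs_index_def)

lemma obs_noise_apply: "obs_noise t d X j y = y j - transpose (X (t (fst j))) *v d (fst j) (snd j)"
  by (simp add: obs_noise_def case_prod_beta)

lemma obs_density_eq:
  "obs_density n t d \<sigma> X y = (\<Prod>j\<in>obs_index n. gaussian_density ((\<sigma> (fst j) (snd j))\<^sup>2 *\<^sub>R mat 1) (obs_noise t d X j y))"
  unfolding obs_density_def by (simp add: case_prod_beta)

lemma obs_lawD:
  assumes "obs_law n t d \<sigma> X \<mu>"
  shows "prob_space \<mu>" "sets \<mu> = sets (\<Pi>\<^sub>M j\<in>obs_index n. borel)"
    and "prob_space.indep_vars \<mu> (\<lambda>_. borel) (obs_noise t d X) (obs_index n)"
    and "j \<in> obs_index n \<Longrightarrow> distributed \<mu> lborel (obs_noise t d X j)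
      (\<lambda>v. ennreal (gaussian_density ((\<sigma> (fst j) (snd j))\<^sup>2 *\<^sub>R mat 1) v))"
proof -
  show "prob_space \<mu>" "sets \<mu> = sets (\<Pi>\<^sub>M j\<in>obs_index n. borel)"
    "prob_space.indep_vars \<mu> (\<lambda>_. borel) (obs_noise t d X) (obs_index n)"
    using assms unfolding obs_law_def obs_space_def by blast+
  have "\<forall>j\<in>obs_index n. distributed \<mu> lborel (obs_noise t d X (fst j, snd j))
      (\<lambda>v. ennreal (gaussian_density ((\<sigma> (fst j) (snd j))\<^sup>2 *\<^sub>R mat 1) v))"
    using assms unfolding obs_law_def case_prod_beta by blast
  then show "j \<in> obs_index n \<Longrightarrow> distributed \<mu> lborel (obs_noise t d X j)
      (\<lambda>v. ennreal (gaussian_density ((\<sigma> (fst j) (snd j))\<^sup>2 *\<^sub>R mat 1) v))"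
    by simp
qed

definition score ::
    "nat \<Rightarrow> (nat \<Rightarrow> real) \<Rightarrow> (nat \<Rightarrow> nat \<Rightarrow> real^3) \<Rightarrow> (nat \<Rightarrow> nat \<Rightarrow> real) \<Rightarrow>
     (real \<Rightarrow> real^3^3) \<Rightarrow> real^3 \<Rightarrow> obs \<Rightarrow> real" where
  "score n t d \<sigma> X u y = (\<Sum>(k, i)\<in>obs_index n.
     ((1 / (\<sigma> k i)\<^sup>2) *\<^sub>R (transpose (X (t k)) *v cross3 (d k i) u)) \<bullet> obs_noise t d X (k, i) y)"

lemma score_eq:
  "score n t d \<sigma> X u y = (\<Sum>j\<in>obs_index n. ((1 / (\<sigma> (fst j) (snd j))\<^sup>2) *\<^sub>R
     (transpose (X (t (fst j))) *v cross3 (d (fst j) (snd j)) u)) \<bullet> obs_noise t d X j y)"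
  unfolding score_def by (simp add: case_prod_beta)

lemma info_matrix_quadratic:
  "u \<bullet> (info_matrix n d \<sigma> *v u) = (\<Sum>(k, i)\<in>obs_index n. (1 / (\<sigma> k i)\<^sup>2) * (norm (cross3 (d k i) u))\<^sup>2)"
proof -
  have lin: "linear (\<lambda>A::real^3^3. u \<bullet> (A *v u))"
    by (rule linearI) (simp_all add: matrix_vector_mult_add_rdistrib inner_add_right scaleR_matrix_vector_assoc[symmetric])
  have "u \<bullet> ((transpose H ** H) *v u) = (norm (H *v u))\<^sup>2" for H :: "real^3^3"
    by (simp add: power2_norm_eq_inner matrix_vector_mul_assoc[symmetric] dot_lmul_matrix[symmetric]
        vector_transpose_matrix flip: transpose_matrix_vector)
  then have *: "u \<bullet> (((1 / s) *\<^sub>R (transpose (cross_matrix v) ** cross_matrix v)) *v u) = (1 / s) * (norm (cross3 v u))\<^sup>2" for s v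
    by (simp add: scaleR_matrix_vector_assoc[symmetric] Defs.cross_matrix_mult)
  show ?thesis
    unfolding info_matrix_def linear_sum[OF lin, unfolded o_def] obs_index_def sum.cartesian_product
    by (simp only: case_prod_unfold *)
qed

lemma norm_rotation_transpose:
  assumes "rotation_matrix (Q :: real^3^3)"
  shows "norm (transpose Q *v v) = norm v"
proof -
  have "orthogonal_matrix (transpose Q)"
    using assms by (simp add: rotation_matrix_def orthogonal_matrix_transpose)
  then have "orthogonal_transformation ((*v) (transpose Q))"
    by (simp add: orthogonal_transformation_matrix)
  then show ?thesis
    by (simp add: orthogonal_transformation)
qed

lemma score_moments:
  assumes law: "obs_law n t d \<sigma> X \<mu>"
    and \<sigma>: "\<forall>k\<in>{1..n}. \<forall>i\<in>{0, 1}. \<sigma> k i > 0"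
    and X: "\<forall>k\<in>{1..n}. rotation_matrix (X (t k))"
  shows "integrable \<mu> (score n t d \<sigma> X u)"
    and "integrable \<mu> (\<lambda>y. (score n t d \<sigma> X u y)\<^sup>2)"
    and "(\<integral>y. (score n t d \<sigma> X u y)\<^sup>2 \<partial>\<mu>) = u \<bullet> (info_matrix n d \<sigma> *v u)"
proof -
  interpret prob_space \<mu>
    by (rule obs_lawD(1)[OF law])
  define s where "s j = \<sigma> (fst j) (snd j)" for j
  define a where "a j = (1 / (s j)\<^sup>2) *\<^sub>R (transpose (X (t (fst j))) *v cross3 (d (fst j) (snd j)) u)" for j
  let ?Z = "\<lambda>j y. a j \<bullet> obs_noise t d X j y"
  have s: "s j > 0" if "j \<in> obs_index n" for j
    using that \<sigma> by (auto simp: s_def obs_index_def)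
  have D: "distributed \<mu> lborel (obs_noise t d X j) (\<lambda>v. ennreal (gaussian_density ((s j)\<^sup>2 *\<^sub>R mat 1) v))"
    if "j \<in> obs_index n" for j
    unfolding s_def by (rule obs_lawD(4)[OF law that])
  have sc: "score n t d \<sigma> X u = (\<lambda>y. \<Sum>j\<in>obs_index n. ?Z j y)"
    unfolding score_eq a_def s_def ..
  have Z: "integrable \<mu> (?Z j)" "expectation (?Z j) = 0" "integrable \<mu> (\<lambda>y. (?Z j y)\<^sup>2)"
    "expectation (\<lambda>y. (?Z j y)\<^sup>2) = (s j)\<^sup>2 * (norm (a j))\<^sup>2" if j: "j \<in> obs_index n" for j
  proof -
    note pos = less_imp_le[OF gaussian_density_pos[OF s[OF j]]]
    note m = gaussian_density_moments[OF s[OF j], of "a j", unfolded has_bochner_integral_iff]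
    show "integrable \<mu> (?Z j)"
      using distributed_integrable[OF D[OF j], of "\<lambda>v. a j \<bullet> v"] pos m by simp
    show "expectation (?Z j) = 0"
      using distributed_integral[OF D[OF j], of "\<lambda>v. a j \<bullet> v"] pos m by simp
    show "integrable \<mu> (\<lambda>y. (?Z j y)\<^sup>2)"
      using distributed_integrable[OF D[OF j], of "\<lambda>v. (a j \<bullet> v)\<^sup>2"] pos m by simp
    show "expectation (\<lambda>y. (?Z j y)\<^sup>2) = (s j)\<^sup>2 * (norm (a j))\<^sup>2"
      using distributed_integral[OF D[OF j], of "\<lambda>v. (a j \<bullet> v)\<^sup>2"] pos m by simp
  qed
  have indep: "indep_vars (\<lambda>_. borel) ?Z (obs_index n)"
    by (rule indep_vars_compose2[OF obs_lawD(3)[OF law]]) simp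
  show "integrable \<mu> (score n t d \<sigma> X u)"
    unfolding sc using Z by (intro Bochner_Integration.integrable_sum) auto
  show "integrable \<mu> (\<lambda>y. (score n t d \<sigma> X u y)\<^sup>2)"
    unfolding sc by (rule second_moment_sum_indep_centered[OF finite_obs_index indep Z(1-3)])
  have "expectation (\<lambda>y. (score n t d \<sigma> X u y)\<^sup>2) = (\<Sum>j\<in>obs_index n. (s j)\<^sup>2 * (norm (a j))\<^sup>2)"
    unfolding sc using second_moment_sum_indep_centered(2)[OF finite_obs_index indep Z(1-3)] Z(4) by simp
  also have "\<dots> = (\<Sum>j\<in>obs_index n. (1 / (s j)\<^sup>2) * (norm (cross3 (d (fst j) (snd j)) u))\<^sup>2)"
  proof (rule sum.cong[OF refl])
    fix j assume j: "j \<in> obs_index n"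
    then have "norm (a j) = (1 / (s j)\<^sup>2) * norm (cross3 (d (fst j) (snd j)) u)"
      using norm_rotation_transpose[of "X (t (fst j))"] X by (auto simp: a_def obs_index_def)
    then show "(s j)\<^sup>2 * (norm (a j))\<^sup>2 = (1 / (s j)\<^sup>2) * (norm (cross3 (d (fst j) (snd j)) u))\<^sup>2"
      using s[OF j] by (simp add: power_mult_distrib power_divide power2_eq_square)
  qed
  also have "\<dots> = u \<bullet> (info_matrix n d \<sigma> *v u)"
    unfolding info_matrix_quadratic by (simp add: s_def case_prod_beta)
  finally show "(\<integral>y. (score n t d \<sigma> X u y)\<^sup>2 \<partial>\<mu>) = u \<bullet> (info_matrix n d \<sigma> *v u)" .
qed

lemma obs_law_eq_density:
  assumes law: "obs_law n t d \<sigma> X \<mu>" and n: "n \<ge> 1"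
    and \<sigma>: "\<forall>k\<in>{1..n}. \<forall>i\<in>{0, 1}. \<sigma> k i > 0"
  shows "\<mu> = density (\<Pi>\<^sub>M j\<in>obs_index n. lborel) (obs_density n t d \<sigma> X)"
proof -
  interpret prob_space \<mu>
    by (rule obs_lawD(1)[OF law])
  define s where "s j = \<sigma> (fst j) (snd j)" for j
  define m where "m j = transpose (X (t (fst j))) *v d (fst j) (snd j)" for j
  let ?g = "\<lambda>j v. gaussian_density ((s j)\<^sup>2 *\<^sub>R mat 1) v"
  have s: "s j > 0" if "j \<in> obs_index n" for j
    using that \<sigma> by (auto simp: s_def obs_index_def)
  have [measurable]: "gaussian_density S \<in> borel_measurable borel" for S
    by (rule borel_measurable_gaussian_density)
  have noise: "obs_noise t d X j y = y j - m j" for j y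
    by (simp add: obs_noise_apply m_def)
  have sets: "sets \<mu> = sets (\<Pi>\<^sub>M j\<in>obs_index n. borel)"
    by (rule obs_lawD(2)[OF law])
  then have sp: "space \<mu> = (\<Pi>\<^sub>E j\<in>obs_index n. UNIV)"
    by (simp add: sets_eq_imp_space_eq[OF sets] space_PiM)
  have comp: "(\<lambda>y. y j) \<in> borel_measurable \<mu>" if "j \<in> obs_index n" for j
    using measurable_component_singleton[OF that] by (simp add: measurable_cong_sets[OF sets refl])
  have marginal: "distr \<mu> borel (\<lambda>y. y j) = density lborel (\<lambda>v. ennreal (?g j (v - m j)))" if j: "j \<in> obs_index n" for j
  proof -
    have D: "distributed \<mu> lborel (obs_noise t d X j) (\<lambda>v. ennreal (?g j v))"
      unfolding s_def by (rule obs_lawD(4)[OF law j])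
    have "density lborel (\<lambda>v. ennreal (?g j (v - m j))) = distr (density lborel (\<lambda>v. ennreal (?g j v))) borel (\<lambda>v. v + m j)"
      by (rule distr_shift_density_lborel[symmetric]) measurable
    also have "\<dots> = distr (distr \<mu> lborel (obs_noise t d X j)) borel (\<lambda>v. v + m j)"
      using D by (simp add: distributed_distr_eq_density)
    also have "\<dots> = distr \<mu> borel ((\<lambda>v. v + m j) \<circ> obs_noise t d X j)"
      by (rule distr_distr) (use D in \<open>auto simp: distributed_def\<close>)
    also have "(\<lambda>v. v + m j) \<circ> obs_noise t d X j = (\<lambda>y. y j)"
      by (simp add: noise fun_eq_iff)
    finally show ?thesis ..
  qed
  have "indep_vars (\<lambda>_. borel) (\<lambda>j y. obs_noise t d X j y + m j) (obs_index n)"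
    by (rule indep_vars_compose2[OF obs_lawD(3)[OF law]]) simp
  then have "indep_vars (\<lambda>_. borel) (\<lambda>j y. y j) (obs_index n)"
    by (simp add: noise)
  moreover have "obs_index n \<noteq> {}"
    using n by (auto simp: obs_index_def)
  ultimately have "distr \<mu> (\<Pi>\<^sub>M j\<in>obs_index n. borel) (\<lambda>y. \<lambda>j\<in>obs_index n. y j)
      = (\<Pi>\<^sub>M j\<in>obs_index n. distr \<mu> borel (\<lambda>y. y j))"
    using comp by (subst (asm) indep_vars_iff_distr_eq_PiM') auto
  moreover have "distr \<mu> (\<Pi>\<^sub>M j\<in>obs_index n. borel) (\<lambda>y. \<lambda>j\<in>obs_index n. y j) = distr \<mu> \<mu> (\<lambda>y. y)"
    by (rule distr_cong) (auto simp: sets sp PiE_restrict)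
  ultimately have "\<mu> = (\<Pi>\<^sub>M j\<in>obs_index n. distr \<mu> borel (\<lambda>y. y j))"
    by (simp add: distr_id)
  also have "\<dots> = (\<Pi>\<^sub>M j\<in>obs_index n. density lborel (\<lambda>v. ennreal (?g j (v - m j))))"
    by (rule PiM_cong) (simp_all add: marginal)
  also have "\<dots> = density (\<Pi>\<^sub>M j\<in>obs_index n. lborel) (\<lambda>y. ennreal (\<Prod>j\<in>obs_index n. ?g j (y j - m j)))"
  proof (rule PiM_density[OF finite_obs_index])
    show "prob_space (density lborel (\<lambda>v. ennreal (?g j (v - m j))))" if "j \<in> obs_index n" for j
      unfolding marginal[OF that, symmetric] using comp[OF that] by (rule prob_space_distr)
    show "?g j (v - m j) \<ge> 0" if "j \<in> obs_index n" for j v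
      by (rule less_imp_le[OF gaussian_density_pos[OF s[OF that]]])
  qed (auto intro: lborel.sigma_finite_measure_axioms)
  finally show ?thesis
    by (simp add: obs_density_eq[abs_def] noise s_def)
qed

lemma obs_density_pos:
  assumes "\<forall>k\<in>{1..n}. \<forall>i\<in>{0, 1}. \<sigma> k i > 0"
  shows "obs_density n t d \<sigma> X y > 0"
  unfolding obs_density_eq using assms
  by (intro prod_pos gaussian_density_pos) (auto simp: obs_index_def)

lemma borel_measurable_obs_density: "obs_density n t d \<sigma> X \<in> borel_measurable (\<Pi>\<^sub>M j\<in>obs_index n. lborel)"
proof -
  have "(\<lambda>y. gaussian_density S (y j - v)) \<in> borel_measurable (\<Pi>\<^sub>M j\<in>obs_index n. lborel)"
    if "j \<in> obs_index n" for j v S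
  proof (rule measurable_compose[OF _ borel_measurable_gaussian_density])
    have "(\<lambda>y. y j) \<in> borel_measurable (\<Pi>\<^sub>M j\<in>obs_index n. lborel)"
      using measurable_component_singleton[OF that, of "\<lambda>_. lborel"] by (simp cong: measurable_cong_sets)
    then show "(\<lambda>y. y j - v) \<in> borel_measurable (\<Pi>\<^sub>M j\<in>obs_index n. lborel)"
      by (intro borel_measurable_diff borel_measurable_const)
  qed
  then show ?thesis
    unfolding obs_density_eq[abs_def] obs_noise_apply by (intro borel_measurable_prod) auto
qed

lemma transpose_cross_matrix_mult: "transpose (cross_matrix \<xi>) *v v = cross3 v \<xi>"
  unfolding transpose_cross_matrix by (simp add: so3_entries)

lemma has_real_derivative_obs_density:
  assumes \<sigma>: "\<forall>k\<in>{1..n}. \<forall>i\<in>{0, 1}. \<sigma> k i > 0"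
    and X': "\<And>s k. k \<in> {1..n} \<Longrightarrow> X' s (t k) = so3_exp (s *\<^sub>R \<xi>) ** X (t k)"
  shows "((\<lambda>s. obs_density n t d \<sigma> (X' s) y) has_real_derivative
    obs_density n t d \<sigma> X y * score n t d \<sigma> X \<xi> y) (at 0)"
proof -
  define r where "r j = \<sigma> (fst j) (snd j)" for j
  define C where "C = (\<Prod>j\<in>obs_index n. 1 / sqrt ((2 * pi * (r j)\<^sup>2) ^ 3))"
  define h where "h Z j = - (norm (obs_noise t d Z j y))\<^sup>2 / (2 * (r j)\<^sup>2)" for Z j
  have r: "r j > 0" if "j \<in> obs_index n" for j
    using that \<sigma> by (auto simp: r_def obs_index_def)
  have dens: "obs_density n t d \<sigma> Z y = C * exp (\<Sum>j\<in>obs_index n. h Z j)" for Z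
    unfolding obs_density_eq exp_sum[OF finite_obs_index] C_def prod.distrib[symmetric]
    by (intro prod.cong refl) (simp add: gaussian_density_isotropic[OF r, unfolded r_def] r_def h_def)
  have X'0: "h (X' 0) j = h X j" if "j \<in> obs_index n" for j
    using that X'[of "fst j" 0] by (auto simp: h_def obs_noise_apply so3_exp_0 obs_index_def)
  define z where "z j = ((1 / (r j)\<^sup>2) *\<^sub>R (transpose (X (t (fst j))) *v cross3 (d (fst j) (snd j)) \<xi>))
      \<bullet> obs_noise t d X j y" for j
  have h: "((\<lambda>s. h (X' s) j) has_real_derivative z j) (at 0)" if j: "j \<in> obs_index n" for j
  proof -
    let ?X = "X (t (fst j))" and ?d = "d (fst j) (snd j)"
    have k: "fst j \<in> {1..n}"
      using j by (auto simp: obs_index_def)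
    have noise: "obs_noise t d (X' s) j y = y j - transpose (so3_exp (s *\<^sub>R \<xi>) ** ?X) *v ?d" for s
      by (simp only: obs_noise_apply X'[OF k])
    have "((\<lambda>s. so3_exp (s *\<^sub>R \<xi>) ** ?X) has_vector_derivative cross_matrix \<xi> ** ?X) (at 0)"
      by (rule bounded_linear.has_vector_derivative[OF
            bounded_bilinear.bounded_linear_left[OF bounded_bilinear_matrix_mult]
            has_vector_derivative_so3_exp_line])
    then have "((\<lambda>s. transpose (so3_exp (s *\<^sub>R \<xi>) ** ?X) *v ?d) has_vector_derivative
        transpose (cross_matrix \<xi> ** ?X) *v ?d) (at 0)"
      by (intro bounded_linear.has_vector_derivative[OF
            bounded_bilinear.bounded_linear_left[OF bounded_bilinear_matrix_vector_mult]]
          bounded_linear.has_vector_derivative[OF bounded_linear_transpose])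
    then have D: "((\<lambda>s. obs_noise t d (X' s) j y) has_vector_derivative
        0 - transpose (cross_matrix \<xi> ** ?X) *v ?d) (at 0)"
      unfolding noise by (intro has_vector_derivative_diff has_vector_derivative_const)
    have "transpose (cross_matrix \<xi> ** ?X) *v ?d = transpose ?X *v (transpose (cross_matrix \<xi>) *v ?d)"
      by (simp only: matrix_transpose_mul matrix_vector_mul_assoc)
    also have "transpose (cross_matrix \<xi>) *v ?d = cross3 ?d \<xi>"
      by (rule transpose_cross_matrix_mult)
    finally have D: "((\<lambda>s. obs_noise t d (X' s) j y) has_vector_derivative - (transpose ?X *v cross3 ?d \<xi>)) (at 0)"
      using D by (simp only: diff_0)
    have N0: "obs_noise t d (X' 0) j y = obs_noise t d X j y"
      unfolding noise by (simp only: scaleR_zero_left so3_exp_0 matrix_mul_lid obs_noise_apply)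
    let ?N = "obs_noise t d X j y" and ?v = "transpose ?X *v cross3 ?d \<xi>"
    have "((\<lambda>s. obs_noise t d (X' s) j y \<bullet> obs_noise t d (X' s) j y) has_real_derivative
        ?N \<bullet> (- ?v) + (- ?v) \<bullet> ?N) (at 0)"
      unfolding has_real_derivative_iff_has_vector_derivative
      using bounded_bilinear.has_vector_derivative[OF bounded_bilinear_inner D D] unfolding N0 .
    then have "((\<lambda>s. - (obs_noise t d (X' s) j y \<bullet> obs_noise t d (X' s) j y) / (2 * (r j)\<^sup>2)) has_real_derivative
        - (?N \<bullet> (- ?v) + (- ?v) \<bullet> ?N) / (2 * (r j)\<^sup>2)) (at 0)"
      by (intro DERIV_cdivide DERIV_minus)
    moreover have "- (?N \<bullet> (- ?v) + (- ?v) \<bullet> ?N) / (2 * (r j)\<^sup>2) = z j"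
      unfolding z_def inner_minus_left inner_minus_right inner_scaleR_left inner_commute[of ?N ?v] by simp
    ultimately show ?thesis
      unfolding h_def power2_norm_eq_inner by simp
  qed
  have "((\<lambda>s. C * exp (\<Sum>j\<in>obs_index n. h (X' s) j)) has_real_derivative
      C * (exp (\<Sum>j\<in>obs_index n. h (X' 0) j) * (\<Sum>j\<in>obs_index n. z j))) (at 0)"
    by (intro DERIV_cmult DERIV_fun_exp DERIV_sum h)
  moreover have "(\<Sum>j\<in>obs_index n. h (X' 0) j) = (\<Sum>j\<in>obs_index n. h X j)"
    by (intro sum.cong refl X'0)
  moreover have "(\<Sum>j\<in>obs_index n. z j) = score n t d \<sigma> X \<xi> y"
    unfolding score_eq z_def r_def ..
  ultimately show ?thesis
    unfolding dens by (simp only: mult.assoc)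
qed

lemma so3_log_works:
  assumes "M \<in> so3_log_dom"
  shows "norm (so3_log M) < pi" "so3_exp (so3_log M) = M"
  using inv_into_into[of M so3_exp "ball 0 pi"] f_inv_into_f[of M so3_exp "ball 0 pi"] assms
  unfolding so3_log_def so3_log_dom_def by auto

lemma rotation_matrix_mult:
  fixes A B :: "real^3^3"
  shows "rotation_matrix A \<Longrightarrow> rotation_matrix B \<Longrightarrow> rotation_matrix (A ** B)"
  by (simp add: rotation_matrix_def orthogonal_matrix_mul det_mul)

lemma inner_matrix_vector_symmetric:
  fixes A :: "real^3^3"
  assumes "transpose A = A"
  shows "x \<bullet> (A *v y) = (A *v x) \<bullet> y"
  using assms by (metis dot_lmul_matrix transpose_matrix_vector)

lemma transpose_info_matrix: "transpose (info_matrix n d \<sigma>) = info_matrix n d \<sigma>"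
proof -
  have "transpose ((1 / s) *\<^sub>R (transpose H ** H)) = (1 / s) *\<^sub>R (transpose H ** H)" for H :: "real^3^3" and s
    by (simp only: transpose_scalar matrix_transpose_mul transpose_transpose)
  then show ?thesis
    unfolding info_matrix_def
    by (simp only: linear_sum[OF bounded_linear.linear[OF bounded_linear_transpose], unfolded o_def])
qed

locale attitude_estimation =
  fixes n :: nat and t :: "nat \<Rightarrow> real" and \<omega> :: "real \<Rightarrow> real^3" and d :: "nat \<Rightarrow> nat \<Rightarrow> real^3"
    and \<sigma> :: "nat \<Rightarrow> nat \<Rightarrow> real" and R :: "real^3^3 \<Rightarrow> real \<Rightarrow> real^3^3" and \<mu> :: "real^3^3 \<Rightarrow> obs measure"
    and Rhat :: "obs \<Rightarrow> real^3^3" and \<Theta> :: "(real^3^3) set" and Q :: "real^3^3"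
  assumes n: "n \<ge> 1"
    and t: "mono_on {1..n} t"
    and \<sigma>: "\<forall>k\<in>{1..n}. \<forall>i\<in>{0, 1}. \<sigma> k i > 0"
    and model: "\<forall>Q'. rotation_matrix Q' \<longrightarrow>
         attitude_trajectory {t 1..t n} \<omega> (R Q') \<and> R Q' (t n) = Q' \<and>
         obs_law n t d \<sigma> (R Q') (\<mu> Q')"
    and \<Theta>: "openin (top_of_set {Q'. rotation_matrix Q'}) \<Theta>"
    and unbiased: "\<forall>Q'\<in>\<Theta>. unbiased_at \<mu> Rhat Q'"
    and Q: "Q \<in> \<Theta>"
    and diff: "\<forall>\<xi>. differentiable_under_integral (\<Pi>\<^sub>M j\<in>obs_index n. lborel)
         (\<lambda>s y. obs_density n t d \<sigma> (R (so3_exp (s *\<^sub>R \<xi>) ** Q)) y *\<^sub>R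
                attitude_error Rhat (so3_exp (s *\<^sub>R \<xi>) ** Q) y) 0"
begin

abbreviation "leb \<equiv> \<Pi>\<^sub>M j\<in>obs_index n. (lborel :: (real^3) measure)"
abbreviation "err Q' \<equiv> attitude_error Rhat Q'"
abbreviation "dens Q' \<equiv> obs_density n t d \<sigma> (R Q')"

lemma rotation_\<Theta>: "Q' \<in> \<Theta> \<Longrightarrow> rotation_matrix Q'"
  using openin_subset[OF \<Theta>] by auto

lemma dens_pos: "dens Q' y > 0"
  by (rule obs_density_pos[OF \<sigma>])

lemma dens_measurable [measurable]: "dens Q' \<in> borel_measurable leb"
  by (rule borel_measurable_obs_density)

lemma law: "rotation_matrix Q' \<Longrightarrow> \<mu> Q' = density leb (dens Q')"
  using model by (intro obs_law_eq_density[OF _ n \<sigma>]) blast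

lemma rotation_perturbed: "rotation_matrix (so3_exp \<xi> ** Q)"
  by (intro rotation_matrix_mult rotation_matrix_so3_exp rotation_\<Theta> Q)

lemma trajectory_perturbed:
  assumes k: "k \<in> {1..n}"
  shows "R (so3_exp \<xi> ** Q) (t k) = so3_exp \<xi> ** R Q (t k)"
proof (rule attitude_trajectory_left_translate)
  show "attitude_trajectory {t 1..t n} \<omega> (R (so3_exp \<xi> ** Q))" "attitude_trajectory {t 1..t n} \<omega> (R Q)"
    using model rotation_perturbed rotation_\<Theta>[OF Q] by blast+
  show "t k \<in> {t 1..t n}" "t n \<in> {t 1..t n}"
    using n k by (auto intro!: mono_onD[OF t])
  show "R (so3_exp \<xi> ** Q) (t n) = so3_exp \<xi> ** R Q (t n)"
    using model rotation_perturbed rotation_\<Theta>[OF Q] by metis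
qed simp

lemma AE_law:
  assumes "rotation_matrix Q'"
  shows "(AE y in \<mu> Q'. P y) \<longleftrightarrow> (AE y in leb. P y)"
  unfolding law[OF assms] by (subst AE_density) (simp_all add: dens_pos)

lemma perturbed_in_\<Theta>: "\<forall>\<^sub>F s in nhds 0. so3_exp (s *\<^sub>R \<xi>) ** Q \<in> \<Theta>"
proof -
  obtain U where U: "open U" "\<Theta> = {Q'. rotation_matrix Q'} \<inter> U"
    using \<Theta> by (auto simp: openin_open)
  have "((\<lambda>s. so3_exp (s *\<^sub>R \<xi>) ** Q) has_vector_derivative cross_matrix \<xi> ** Q) (at 0)"
    by (rule bounded_linear.has_vector_derivative[OF
          bounded_bilinear.bounded_linear_left[OF bounded_bilinear_matrix_mult]
          has_vector_derivative_so3_exp_line])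
  then have "isCont (\<lambda>s. so3_exp (s *\<^sub>R \<xi>) ** Q) 0"
    by (rule has_vector_derivative_continuous)
  then have "((\<lambda>s. so3_exp (s *\<^sub>R \<xi>) ** Q) \<longlongrightarrow> so3_exp (0 *\<^sub>R \<xi>) ** Q) (nhds 0)"
    unfolding isCont_def by (rule tendsto_at_iff_tendsto_nhds[THEN iffD1])
  then have "((\<lambda>s. so3_exp (s *\<^sub>R \<xi>) ** Q) \<longlongrightarrow> Q) (nhds 0)"
    by (simp add: so3_exp_0)
  then have "\<forall>\<^sub>F s in nhds 0. so3_exp (s *\<^sub>R \<xi>) ** Q \<in> U"
    using U Q by (auto elim: topological_tendstoD)
  then show ?thesis
    by eventually_elim (simp add: U rotation_perturbed)
qed

lemma integral_err_law:
  assumes Q': "rotation_matrix Q'" and int: "integrable leb (\<lambda>y. dens Q' y *\<^sub>R err Q' y)"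
  shows "err Q' \<in> borel_measurable leb"
    and "(\<integral>y. dens Q' y *\<^sub>R err Q' y \<partial>leb) = (\<integral>y. err Q' y \<partial>\<mu> Q')"
proof -
  have "(\<lambda>y. (1 / dens Q' y) *\<^sub>R (dens Q' y *\<^sub>R err Q' y)) \<in> borel_measurable leb"
    by (intro borel_measurable_scaleR borel_measurable_divide borel_measurable_const dens_measurable
        borel_measurable_integrable[OF int])
  then show *: "err Q' \<in> borel_measurable leb"
    using dens_pos[of Q'] by (simp add: less_imp_neq[THEN not_sym])
  show "(\<integral>y. dens Q' y *\<^sub>R err Q' y \<partial>leb) = (\<integral>y. err Q' y \<partial>\<mu> Q')"
    unfolding law[OF Q'] using * dens_pos by (intro integral_density[symmetric]) (auto intro: less_imp_le)
qed

lemma differentiated_unbiasedness: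
  fixes \<xi> :: "real^3"
  defines "F s \<equiv> \<lambda>y. dens (so3_exp (s *\<^sub>R \<xi>) ** Q) y *\<^sub>R err (so3_exp (s *\<^sub>R \<xi>) ** Q) y"
  shows "integrable leb (\<lambda>y. vector_derivative (\<lambda>s. F s y) (at 0))"
    and "(\<integral>y. vector_derivative (\<lambda>s. F s y) (at 0) \<partial>leb) = 0"
    and "AE y in leb. (\<lambda>s. F s y) differentiable (at 0)"
    and "integrable leb (F 0)"
proof -
  have D: "\<forall>\<^sub>F s in nhds 0. integrable leb (F s)"
    "AE y in leb. (\<lambda>s. F s y) differentiable (at 0)"
    "integrable leb (\<lambda>y. vector_derivative (\<lambda>s. F s y) (at 0))"
    "((\<lambda>s. \<integral>y. F s y \<partial>leb) has_vector_derivative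
        (\<integral>y. vector_derivative (\<lambda>s. F s y) (at 0) \<partial>leb)) (at 0)"
    using diff unfolding differentiable_under_integral_def F_def by blast+
  show "integrable leb (\<lambda>y. vector_derivative (\<lambda>s. F s y) (at 0))"
    "AE y in leb. (\<lambda>s. F s y) differentiable (at 0)"
    by (fact D)+
  show "integrable leb (F 0)"
    by (rule eventually_nhds_x_imp_x[OF D(1)])
  have "\<forall>\<^sub>F s in nhds 0. (\<integral>y. F s y \<partial>leb) = 0"
    using D(1) perturbed_in_\<Theta>[of \<xi>]
  proof eventually_elim
    case (elim s)
    then show ?case
      using integral_err_law(2)[OF rotation_perturbed] unbiased unfolding F_def unbiased_at_def by simp
  qed
  then have "((\<lambda>s. \<integral>y. F s y \<partial>leb) has_vector_derivative 0) (at 0)"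
    using has_vector_derivative_const[of "0::real^3" "at (0::real)"]
    by (subst has_vector_derivative_cong_ev[where g = "\<lambda>_. 0"]) (auto dest: eventually_nhds_x_imp_x elim: eventually_mono)
  then show "(\<integral>y. vector_derivative (\<lambda>s. F s y) (at 0) \<partial>leb) = 0"
    using D(4) by (intro vector_derivative_unique_at)
qed

lemma score_identity:
  obtains W where "integrable (\<mu> Q) W" "(\<integral>y. W y \<partial>\<mu> Q) = 0"
    and "AE y in \<mu> Q. norm (W y - score n t d \<sigma> (R Q) \<xi> y *\<^sub>R err Q y -
        (\<xi> - (1 / 2) *\<^sub>R cross3 (err Q y) \<xi> + (1 / 12) *\<^sub>R cross3 (err Q y) (cross3 (err Q y) \<xi>)))
        \<le> norm (err Q y) ^ 3 * norm \<xi>"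
proof -
  define q where "q s = so3_exp (s *\<^sub>R \<xi>) ** Q" for s
  define F where "F s y = dens (q s) y *\<^sub>R err (q s) y" for s y
  define G where "G y = vector_derivative (\<lambda>s. F s y) (at 0)" for y
  define W where "W y = (1 / dens Q y) *\<^sub>R G y" for y
  have q0: "q 0 = Q"
    by (simp add: q_def so3_exp_0)
  have rot: "rotation_matrix (q s)" for s
    unfolding q_def by (rule rotation_perturbed)
  have rotQ: "rotation_matrix Q"
    using rotation_\<Theta>[OF Q] .
  have du: "integrable leb G" "(\<integral>y. G y \<partial>leb) = 0" "AE y in leb. (\<lambda>s. F s y) differentiable (at 0)"
    using differentiated_unbiasedness(1-3)[of \<xi>] unfolding G_def F_def q_def by blast+
  have GW: "dens Q y *\<^sub>R W y = G y" for y
    using dens_pos[of Q y] by (simp add: W_def)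
  have W_meas: "W \<in> borel_measurable leb"
    unfolding W_def
    by (intro borel_measurable_scaleR borel_measurable_divide borel_measurable_const dens_measurable
        borel_measurable_integrable[OF du(1)])
  have dens_nn: "AE y in leb. 0 \<le> dens Q y"
    using dens_pos[of Q] by (intro AE_I2) (auto intro: less_imp_le)
  have "integrable (\<mu> Q) W"
    unfolding law[OF rotQ] integrable_density[OF W_meas dens_measurable dens_nn] GW by (rule du(1))
  moreover have "(\<integral>y. W y \<partial>\<mu> Q) = 0"
    unfolding law[OF rotQ] integral_density[OF W_meas dens_measurable dens_nn] GW by (rule du(2))
  moreover obtain \<delta> where \<delta>: "\<delta> > 0" "\<And>s. \<bar>s\<bar> < \<delta> \<Longrightarrow> q s \<in> \<Theta>"
    using perturbed_in_\<Theta>[of \<xi>] unfolding q_def eventually_nhds_metric by auto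
  define \<tau> where "\<tau> j = \<delta> / 2 * inverse (real (Suc j))" for j
  have \<tau>: "filterlim \<tau> (at 0) sequentially"
  proof (rule filterlim_atI)
    show "\<tau> \<longlonglongrightarrow> 0"
      unfolding \<tau>_def by (rule tendsto_mult_right_zero[OF LIMSEQ_inverse_real_of_nat])
    show "\<forall>\<^sub>F j in sequentially. \<tau> j \<noteq> 0"
      using \<delta> by (simp add: \<tau>_def)
  qed
  have \<tau>_\<Theta>: "q (\<tau> j) \<in> \<Theta>" for j
  proof (rule \<delta>(2))
    have "inverse (real (Suc j)) \<le> 1"
      by (simp add: field_simps)
    then have "\<delta> / 2 * inverse (real (Suc j)) \<le> \<delta> / 2 * 1"
      using \<delta> by (intro mult_left_mono) auto
    then show "\<bar>\<tau> j\<bar> < \<delta>"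
      using \<delta> unfolding \<tau>_def by (simp add: abs_mult)
  qed
  have dom: "AE y in leb. Q' ** transpose (Rhat y) \<in> so3_log_dom" if "Q' \<in> \<Theta>" for Q'
    using unbiased that unfolding AE_law[OF rotation_\<Theta>[OF that], symmetric] unbiased_at_def by blast
  have "AE y in leb. \<forall>j. q (\<tau> j) ** transpose (Rhat y) \<in> so3_log_dom"
    unfolding AE_all_countable using dom[OF \<tau>_\<Theta>] ..
  with dom[OF Q] du(3)
  have "AE y in leb. norm (W y - score n t d \<sigma> (R Q) \<xi> y *\<^sub>R err Q y -
        (\<xi> - (1 / 2) *\<^sub>R cross3 (err Q y) \<xi> + (1 / 12) *\<^sub>R cross3 (err Q y) (cross3 (err Q y) \<xi>)))
        \<le> norm (err Q y) ^ 3 * norm \<xi>"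
  proof eventually_elim
    case (elim y)
    define e where "e s = err (q s) y" for s
    have e0: "e 0 = err Q y"
      by (simp add: e_def q0)
    have dp: "((\<lambda>s. dens (q s) y) has_real_derivative dens Q y * score n t d \<sigma> (R Q) \<xi> y) (at 0)"
      by (rule has_real_derivative_obs_density[OF \<sigma>]) (simp add: q_def trajectory_perturbed)
    have "((\<lambda>s. 1 / dens (q s) y) has_real_derivative
        (0 * dens (q 0) y - 1 * (dens Q y * score n t d \<sigma> (R Q) \<xi> y)) / (dens (q 0) y * dens (q 0) y)) (at 0)"
      using dens_pos[of "q 0" y] by (intro DERIV_divide DERIV_const dp) simp
    moreover have "((\<lambda>s. F s y) has_vector_derivative G y) (at 0)"
      using elim(2) by (simp add: vector_derivative_works G_def)
    ultimately obtain v where "((\<lambda>s. (1 / dens (q s) y) *\<^sub>R F s y) has_vector_derivative v) (at 0)"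
      using has_vector_derivative_scaleR by blast
    moreover have "(1 / dens (q s) y) *\<^sub>R F s y = e s" for s
      using dens_pos[of "q s" y] by (simp add: F_def e_def)
    ultimately have De: "(e has_vector_derivative v) (at 0)"
      by simp
    have "((\<lambda>s. F s y) has_vector_derivative
        dens (q 0) y *\<^sub>R v + (dens Q y * score n t d \<sigma> (R Q) \<xi> y) *\<^sub>R e 0) (at 0)"
      unfolding F_def e_def[symmetric] by (rule has_vector_derivative_scaleR[OF dp De])
    then have "G y = dens Q y *\<^sub>R (v + score n t d \<sigma> (R Q) \<xi> y *\<^sub>R err Q y)"
      unfolding G_def by (subst vector_derivative_at) (simp_all add: q0 e0 scaleR_add_right)
    then have v: "W y - score n t d \<sigma> (R Q) \<xi> y *\<^sub>R err Q y = v"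
      using dens_pos[of Q y] by (simp add: W_def)
    have "norm (e 0) < pi" "so3_exp (e 0) = Q ** transpose (Rhat y)"
      using so3_log_works[OF elim(1)] by (simp_all add: e0 attitude_error_def)
    moreover have "so3_exp (e (\<tau> j)) = so3_exp (\<tau> j *\<^sub>R \<xi>) ** (Q ** transpose (Rhat y))" for j
      using so3_log_works(2)[OF spec[OF elim(3), of j]]
      by (simp add: e_def attitude_error_def q_def matrix_mul_assoc)
    ultimately show ?case
      using log_velocity_bound[OF De _ \<tau>, of \<xi>] unfolding v e0 by simp
  qed
  then have "AE y in \<mu> Q. norm (W y - score n t d \<sigma> (R Q) \<xi> y *\<^sub>R err Q y -
        (\<xi> - (1 / 2) *\<^sub>R cross3 (err Q y) \<xi> + (1 / 12) *\<^sub>R cross3 (err Q y) (cross3 (err Q y) \<xi>)))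
        \<le> norm (err Q y) ^ 3 * norm \<xi>"
    unfolding AE_law[OF rotQ] .
  ultimately show thesis
    by (rule that)
qed

lemma bounded_error_Q: "bounded_error (\<mu> Q) (err Q) pi"
proof -
  have rotQ: "rotation_matrix Q"
    using rotation_\<Theta>[OF Q] .
  have "prob_space (\<mu> Q)"
    using model rotQ obs_lawD(1) by blast
  moreover have "err Q \<in> borel_measurable (\<mu> Q)"
    unfolding law[OF rotQ] using integral_err_law(1)[OF rotQ] differentiated_unbiasedness(4)[of 0]
    by (simp add: so3_exp_0)
  moreover have "AE y in \<mu> Q. Q ** transpose (Rhat y) \<in> so3_log_dom"
    using unbiased Q unfolding unbiased_at_def by blast
  then have "AE y in \<mu> Q. norm (err Q y) \<le> pi"
    by eventually_elim (auto simp: attitude_error_def intro: less_imp_le so3_log_works)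
  ultimately show ?thesis
    by (simp add: bounded_error_def bounded_error_axioms_def)
qed

text \<open>The remainder only has to dominate a quadratic form, so a multiple of the identity serves as the
  matrix \<open>E\<close> of the theorem.\<close>

lemma covariance_bound:
  assumes inv: "invertible (info_matrix n d \<sigma>)"
  defines "Ji \<equiv> matrix_inv (info_matrix n d \<sigma>)"
    and "P \<equiv> error_covariance \<mu> Rhat Q"
  defines "A \<equiv> trace P *\<^sub>R mat 1 - P"
    and "\<epsilon> \<equiv> 2 * onorm ((*v) Ji) * (\<integral>y. norm (err Q y) ^ 3 \<partial>\<mu> Q)"
  shows "loewner_le (Ji - (1 / 12) *\<^sub>R (A ** Ji) - (1 / 12) *\<^sub>R (Ji ** A) + (- \<epsilon>) *\<^sub>R mat 1) P"
proof -
  interpret bounded_error "\<mu> Q" "err Q" pi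
    by (rule bounded_error_Q)
  let ?J = "info_matrix n d \<sigma>"
  have P: "P = second_moment (\<mu> Q) (err Q)"
    by (simp add: P_def error_covariance_def second_moment_def)
  obtain B where "?J ** B = mat 1" "B ** ?J = mat 1"
    using inv by (auto simp: invertible_def)
  then have J: "?J ** Ji = mat 1" "Ji ** ?J = mat 1"
    unfolding Ji_def by (simp_all add: matrix_inv_eqI)
  have tJi: "transpose Ji = Ji"
  proof -
    have "?J ** transpose Ji = mat 1"
      using J(2) by (metis transpose_info_matrix matrix_transpose_mul transpose_mat)
    then show ?thesis
      using J(2) by (metis matrix_mul_assoc matrix_mul_lid matrix_mul_rid)
  qed
  have tP: "transpose P = P"
    unfolding P by (rule transpose_second_moment)
  have tA: "transpose A = A"
    unfolding A_def using tP by (simp add: transpose_def vec_eq_iff mat_def)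
  define D where "D = P - (Ji - (1 / 12) *\<^sub>R (A ** Ji) - (1 / 12) *\<^sub>R (Ji ** A) + (- \<epsilon>) *\<^sub>R mat 1)"
  have lt: "transpose (X + Y) = transpose X + transpose Y" "transpose (X - Y) = transpose X - transpose Y"
    "transpose (c *\<^sub>R X) = c *\<^sub>R transpose X" for X Y :: "real^3^3" and c
    by (simp_all add: so3_entries)
  have "transpose D = D"
    unfolding D_def lt matrix_transpose_mul tJi tA tP transpose_mat by simp
  moreover have "0 \<le> x \<bullet> (D *v x)" for x
  proof -
    define u where "u = Ji *v x"
    define m3 where "m3 = (\<integral>y. norm (err Q y) ^ 3 \<partial>\<mu> Q)"
    have m3: "m3 \<ge> 0"
      unfolding m3_def by simp
    have Ju: "?J *v u = x"
      by (simp add: u_def matrix_vector_mul_assoc J)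
    obtain W where W: "integrable (\<mu> Q) W" "expectation W = 0"
      "AE y in \<mu> Q. norm (W y - score n t d \<sigma> (R Q) u y *\<^sub>R err Q y -
        (u - (1 / 2) *\<^sub>R cross3 (err Q y) u + (1 / 12) *\<^sub>R cross3 (err Q y) (cross3 (err Q y) u)))
        \<le> norm (err Q y) ^ 3 * norm u"
      using score_identity[of u] .
    have lawQ: "obs_law n t d \<sigma> (R Q) (\<mu> Q)" and traj: "attitude_trajectory {t 1..t n} \<omega> (R Q)"
      using model rotation_\<Theta>[OF Q] by blast+
    have "\<forall>k\<in>{1..n}. rotation_matrix (R Q (t k))"
    proof
      fix k assume k: "k \<in> {1..n}"
      have "t k \<in> {t 1..t n}"
        using n k by (auto intro!: mono_onD[OF t])
      then show "rotation_matrix (R Q (t k))"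
        using traj by (simp add: attitude_trajectory_def)
    qed
    note S = score_moments[OF lawQ \<sigma> this, of u]
    have "expectation (err Q) = 0"
      using unbiased Q unfolding unbiased_at_def by blast
    from cramer_rao[OF this S(1,2) W, of x, folded P A_def m3_def]
    have CR: "x \<bullet> (P *v x) - 2 * (x \<bullet> u) + (1 / 6) * (x \<bullet> (A *v u)) + u \<bullet> x \<ge> - 2 * (norm x * norm u * m3)"
      unfolding S(3) Ju A_def .
    have "norm u \<le> onorm ((*v) Ji) * norm x"
      unfolding u_def by (rule onorm[OF matrix_vector_mul_bounded_linear])
    then have "norm x * norm u * m3 \<le> norm x * (onorm ((*v) Ji) * norm x) * m3"
      using m3 by (intro mult_right_mono mult_left_mono) auto
    then have \<epsilon>: "2 * (norm x * norm u * m3) \<le> \<epsilon> * (x \<bullet> x)"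
      unfolding \<epsilon>_def m3_def[symmetric] power2_norm_eq_inner[symmetric] by (simp add: power2_eq_square mult_ac)
    have "x \<bullet> ((Ji ** A) *v x) = u \<bullet> (A *v x)"
      unfolding u_def matrix_vector_mul_assoc[symmetric] by (rule inner_matrix_vector_symmetric[OF tJi])
    also have "\<dots> = x \<bullet> (A *v u)"
      unfolding inner_matrix_vector_symmetric[OF tA, of u x] by (rule inner_commute)
    finally have 1: "x \<bullet> ((Ji ** A) *v x) = x \<bullet> (A *v u)" .
    have 2: "x \<bullet> ((A ** Ji) *v x) = x \<bullet> (A *v u)"
      by (simp only: u_def matrix_vector_mul_assoc)
    have "x \<bullet> (D *v x) = x \<bullet> (P *v x) - x \<bullet> u + (1 / 12) * (x \<bullet> (A *v u)) + (1 / 12) * (x \<bullet> (A *v u)) + \<epsilon> * (x \<bullet> x)"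
      unfolding D_def matrix_vector_mult_diff_rdistrib matrix_vector_mult_add_rdistrib inner_diff_right inner_add_right
        scaleR_matrix_vector_assoc[symmetric] inner_scaleR_right 1 2 u_def[symmetric]
      by simp
    then show ?thesis
      using CR \<epsilon> by (simp add: inner_commute)
  qed
  ultimately show ?thesis
    unfolding loewner_le_def D_def by blast
qed

end

theorem proposition3:
  shows "\<exists>c :: real^3^3 \<Rightarrow> real.
    \<forall>(n::nat) (t :: nat \<Rightarrow> real) (\<omega> :: real \<Rightarrow> real^3) (d :: nat \<Rightarrow> nat \<Rightarrow> real^3)
     (\<sigma> :: nat \<Rightarrow> nat \<Rightarrow> real) (R :: real^3^3 \<Rightarrow> real \<Rightarrow> real^3^3) (\<mu> :: real^3^3 \<Rightarrow> obs measure)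
     (Rhat :: obs \<Rightarrow> real^3^3) (\<Theta> :: (real^3^3) set) (Q :: real^3^3).
      n \<ge> 1 \<longrightarrow>
      mono_on {1..n} t \<longrightarrow>
      (\<forall>k\<in>{1..n}. \<forall>i\<in>{0, 1}. \<sigma> k i > 0) \<longrightarrow>
      (\<forall>Q'. rotation_matrix Q' \<longrightarrow>
         attitude_trajectory {t 1..t n} \<omega> (R Q') \<and> R Q' (t n) = Q' \<and>
         obs_law n t d \<sigma> (R Q') (\<mu> Q')) \<longrightarrow>
      invertible (info_matrix n d \<sigma>) \<longrightarrow>
      Rhat \<in> borel_measurable (obs_space n) \<longrightarrow>
      (\<forall>y\<in>space (obs_space n). rotation_matrix (Rhat y)) \<longrightarrow>
      openin (top_of_set {Q'. rotation_matrix Q'}) \<Theta> \<longrightarrow>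
      (\<forall>Q'\<in>\<Theta>. unbiased_at \<mu> Rhat Q') \<longrightarrow>
      Q \<in> \<Theta> \<longrightarrow>
      (\<forall>\<xi>. differentiable_under_integral (\<Pi>\<^sub>M j\<in>obs_index n. lborel)
         (\<lambda>s y. obs_density n t d \<sigma> (R (so3_exp (s *\<^sub>R \<xi>) ** Q)) y *\<^sub>R
                attitude_error Rhat (so3_exp (s *\<^sub>R \<xi>) ** Q) y) 0) \<longrightarrow>
      (let Ji = matrix_inv (info_matrix n d \<sigma>);
           P = error_covariance \<mu> Rhat Q;
           A = trace P *\<^sub>R mat 1 - P
       in \<exists>E. transpose E = E \<and>
            norm E \<le> c Ji * (\<integral>y. norm (attitude_error Rhat Q y) ^ 3 \<partial>\<mu> Q) \<and>
            loewner_le (Ji - (1 / 12) *\<^sub>R (A ** Ji) - (1 / 12) *\<^sub>R (Ji ** A) + E) P)"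
proof -
  define c :: "real^3^3 \<Rightarrow> real" where "c Ji = 2 * onorm ((*v) Ji) * norm (mat 1 :: real^3^3)" for Ji
  show ?thesis
  proof (intro exI[of _ c] allI impI, goal_cases)
    case (1 n t \<omega> d \<sigma> R \<mu> Rhat \<Theta> Q)
    interpret attitude_estimation n t \<omega> d \<sigma> R \<mu> Rhat \<Theta> Q
      by unfold_locales (fact 1)+
    define Ji where "Ji = matrix_inv (info_matrix n d \<sigma>)"
    define \<epsilon> where "\<epsilon> = 2 * onorm ((*v) Ji) * (\<integral>y. norm (attitude_error Rhat Q y) ^ 3 \<partial>\<mu> Q)"
    have "\<epsilon> \<ge> 0"
      by (simp add: \<epsilon>_def onorm_pos_le[OF matrix_vector_mul_bounded_linear])
    then have "norm ((- \<epsilon>) *\<^sub>R mat 1 :: real^3^3) \<le> c Ji * (\<integral>y. norm (attitude_error Rhat Q y) ^ 3 \<partial>\<mu> Q)"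
      by (simp add: c_def \<epsilon>_def)
    moreover have "transpose ((- \<epsilon>) *\<^sub>R mat 1 :: real^3^3) = (- \<epsilon>) *\<^sub>R mat 1"
      by (simp add: so3_entries)
    ultimately show ?case
      unfolding Let_def Ji_def[symmetric]
      using covariance_bound[OF 1(5), folded Ji_def, folded \<epsilon>_def] by blast
  qed
qed

end
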